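(* Let $(P,r)$ be a finite graded poset of rank $n$ with Möbius function $\mu$, and suppose that the magnitude homology of $P$ is diagonal. Then for every $0\le k\le n$ there are isomorphisms $$H_i(\varDelta^{(k)}(P))\cong H_i(\varDelta(P))\qquad (0\le i\le k-1),$$ and the rank of the top homology group satisfies $$\operatorname{rk} H_k(\varDelta^{(k)}(P))\le \sum_{\substack{x\le y\\ r(y)-r(x)=k}}|\mu(x,y)|.$$
   Context: All homology is with integer coefficients. A finite poset $P$ is graded of rank $n\ge 0$ if every maximal chain of $P$ has length $n$ (i.e. $n+1$ elements); its rank function $r:P\to\{0,\dots,n\}$ satisfies $r(x)=0$ for $x$ minimal and $r(y)=r(x)+1$ if $y$ covers $x$. The order complex $\varDelta(P)$ is the abstract simplicial complex whose simplices are the chains of $P$. For $0\le k\le n$ let $\varDelta^{(k)}(P)=\{(x_0<\cdots<x_l)\mid r(x_l)-r(x_0)\le k\}$, a subcomplex of $\varDelta(P)$. Möbius function: $\mu(x,x)=1$, $\mu(x,y)=-\sum_{x\le z<y}\mu(x,z)$ for $x<y$, and $\mu(x,y)=0$ otherwise. Magnitude homology of $(P,r)$: set $d(x,y)=r(y)-r(x)$ if $x\le y$ and $d(x,y)=\infty$ otherwise, and $L(x_0,\dots,x_m)=\sum_{i=0}^{m-1}d(x_i,x_{i+1})$. Let $\mathrm{MC}^k_m(P)$ be the free abelian group on tuples $(x_0,\dots,x_m)\in P^{m+1}$ with $x_i\ne x_{i+1}$ for all $i$ and $L(x_0,\dots,x_m)=k$. The boundary $\partial:\mathrm{MC}^k_m(P)\to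 \mathrm{MC}^k_{m-1}(P)$ is $\partial=\sum_{i=0}^m(-1)^i\partial_i$, where $\partial_i$ deletes $x_i$ if the resulting tuple still has length $k$ and is $0$ otherwise. Then $\mathrm{MH}^k_m(P)=H_m(\mathrm{MC}^k_*(P),\partial)$. The magnitude homology of $P$ is diagonal if $\mathrm{MH}^k_m(P)=0$ whenever $m\ne k$. *)

theory Defs
  imports "HOL-Algebra.Algebra" "HOL-Algebra.Free_Abelian_Groups" "HOL-Library.Extended_Nat"
begin

section \<open>Graded posets\<close>

text \<open>A poset is a subset \<open>P\<close> of a type of class \<open>order\<close>, with the induced order.\<close>

definition covers_in :: "'a::order set \<Rightarrow> 'a \<Rightarrow> 'a \<Rightarrow> bool" where
  "covers_in P y x \<longleftrightarrow> x \<in> P \<and> y \<in> P \<and> x < y \<and> \<not> (\<exists>z\<in>P. x < z \<and> z < y)"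

definition minimal_in :: "'a::order set \<Rightarrow> 'a \<Rightarrow> bool" where
  "minimal_in P x \<longleftrightarrow> x \<in> P \<and> \<not> (\<exists>y\<in>P. y < x)"

text \<open>The empty poset is not graded: its only maximal chain is empty and so does not have
  \<open>n + 1\<close> elements. In a graded poset \<open>r\<close> is monotone on \<open>P\<close>, so the truncated
  differences \<open>r y - r x\<close> below, all of which are formed for \<open>x \<le> y\<close>, are the true ones.\<close>

definition graded_poset :: "'a::order set \<Rightarrow> ('a \<Rightarrow> nat) \<Rightarrow> nat \<Rightarrow> bool" where
  "graded_poset P r n \<longleftrightarrow>
     finite P \<and>
     (\<forall>C. pred_on.maxchain P (<) C \<longrightarrow> card C = Suc n) \<and>
     (\<forall>x\<in>P. r x \<le> n) \<and>
     (\<forall>x. minimal_in P x \<longrightarrow> r x = 0) \<and>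
     (\<forall>x y. covers_in P y x \<longrightarrow> r y = r x + 1)"

text \<open>The guard \<open>finite P\<close> only serves termination.\<close>

function mobius :: "'a::order set \<Rightarrow> 'a \<Rightarrow> 'a \<Rightarrow> int" where
  "mobius P x y =
     (if x = y then 1
      else if x < y \<and> finite P then - (\<Sum>z\<in>{z \<in> P. x \<le> z \<and> z < y}. mobius P x z)
      else 0)"
  by pat_completeness auto
termination
  by (relation "measure (\<lambda>(P, x, y). card {z \<in> P. z < y})")
     (auto intro!: psubset_card_mono dest: less_trans)

declare mobius.simps [simp del]

section \<open>Homology of chain complexes of free abelian groups\<close>

text \<open>\<open>S m\<close> is the basis of the chain group in degree \<open>m\<close> and \<open>d m\<close> is the boundary map out of
  degree \<open>m\<close>.\<close>

definition complex_homology ::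
  "(nat \<Rightarrow> 'b set) \<Rightarrow> (nat \<Rightarrow> ('b \<Rightarrow>\<^sub>0 int) \<Rightarrow> ('b \<Rightarrow>\<^sub>0 int)) \<Rightarrow> nat \<Rightarrow> ('b \<Rightarrow>\<^sub>0 int) set monoid" where
  "complex_homology S d m =
     subgroup_generated (free_Abelian_group (S m))
       {c \<in> carrier (free_Abelian_group (S m)). d m c = 0}
     Mod (d (Suc m) ` carrier (free_Abelian_group (S (Suc m))))"

definition delete_nth :: "nat \<Rightarrow> 'a list \<Rightarrow> 'a list" where
  "delete_nth i xs = take i xs @ drop (Suc i) xs"

section \<open>The order complex and its subcomplexes\<close>

text \<open>A simplex \<open>x\<^sub>0 < \<dots> < x\<^sub>l\<close> is represented by its strictly increasing list of vertices. The
  order on the vertices orients every simplex compatibly with passing to faces, so the basis of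
  the simplicial chain group in degree \<open>m\<close> consists of the lists of length \<open>m + 1\<close>.
  Homology is unreduced: the boundary vanishes in degree 0.\<close>

definition order_complex :: "'a::order set \<Rightarrow> 'a list set" where
  "order_complex P = {xs. xs \<noteq> [] \<and> set xs \<subseteq> P \<and> sorted_wrt (<) xs}"

definition rank_order_complex :: "'a::order set \<Rightarrow> ('a \<Rightarrow> nat) \<Rightarrow> nat \<Rightarrow> 'a list set" where
  "rank_order_complex P r k = {xs \<in> order_complex P. r (last xs) - r (hd xs) \<le> k}"

definition simplicial_boundary :: "nat \<Rightarrow> ('a list \<Rightarrow>\<^sub>0 int) \<Rightarrow> ('a list \<Rightarrow>\<^sub>0 int)" where
  "simplicial_boundary m c =
     (if m = 0 then 0
      else frag_extend (\<lambda>xs. \<Sum>i\<le>m. frag_cmul ((-1) ^ i) (frag_of (delete_nth i xs))) c)"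

definition simplicial_homology :: "nat \<Rightarrow> 'a list set \<Rightarrow> ('a list \<Rightarrow>\<^sub>0 int) set monoid" where
  "simplicial_homology m K =
     complex_homology (\<lambda>m. {xs \<in> K. length xs = Suc m}) simplicial_boundary m"

section \<open>Magnitude homology\<close>

definition rank_dist :: "('a::order \<Rightarrow> nat) \<Rightarrow> 'a \<Rightarrow> 'a \<Rightarrow> enat" where
  "rank_dist r x y = (if x \<le> y then enat (r y - r x) else \<infinity>)"

definition tuple_length :: "('a::order \<Rightarrow> nat) \<Rightarrow> 'a list \<Rightarrow> enat" where
  "tuple_length r xs = (\<Sum>i<length xs - 1. rank_dist r (xs ! i) (xs ! Suc i))"

definition magnitude_basis :: "'a::order set \<Rightarrow> ('a \<Rightarrow> nat) \<Rightarrow> nat \<Rightarrow> nat \<Rightarrow> 'a list set" where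
  "magnitude_basis P r k m =
     {xs. length xs = Suc m \<and> set xs \<subseteq> P \<and> (\<forall>i<m. xs ! i \<noteq> xs ! Suc i) \<and>
          tuple_length r xs = enat k}"

text \<open>In degree 0 the target is the zero group. A basis tuple is strictly increasing, because its
  length is finite, so deleting an entry never makes two consecutive entries equal; hence the
  result is again a basis tuple whenever it has length \<open>k\<close>.\<close>

definition magnitude_boundary ::
  "('a::order \<Rightarrow> nat) \<Rightarrow> nat \<Rightarrow> nat \<Rightarrow> ('a list \<Rightarrow>\<^sub>0 int) \<Rightarrow> ('a list \<Rightarrow>\<^sub>0 int)" where
  "magnitude_boundary r k m c =
     (if m = 0 then 0
      else frag_extend (\<lambda>xs. \<Sum>i\<le>m. frag_cmul ((-1) ^ i)
             (if tuple_length r (delete_nth i xs) = enat k then frag_of (delete_nth i xs) else 0)) c)"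

definition magnitude_homology ::
  "'a::order set \<Rightarrow> ('a \<Rightarrow> nat) \<Rightarrow> nat \<Rightarrow> nat \<Rightarrow> ('a list \<Rightarrow>\<^sub>0 int) set monoid" where
  "magnitude_homology P r k m =
     complex_homology (magnitude_basis P r k) (magnitude_boundary r k) m"

definition diagonal_magnitude_homology :: "'a::order set \<Rightarrow> ('a \<Rightarrow> nat) \<Rightarrow> bool" where
  "diagonal_magnitude_homology P r \<longleftrightarrow>
     (\<forall>k m. m \<noteq> k \<longrightarrow> trivial_group (magnitude_homology P r k m))"

section \<open>Rank of an abelian group\<close>

definition int_independent :: "('a, 'b) monoid_scheme \<Rightarrow> 'a set \<Rightarrow> bool" where
  "int_independent G B \<longleftrightarrow>
     finite B \<and> B \<subseteq> carrier G \<and>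
     (\<forall>c :: 'a \<Rightarrow> int. finprod G (\<lambda>b. b [^]\<^bsub>G\<^esub> c b) B = \<one>\<^bsub>G\<^esub> \<longrightarrow> (\<forall>b\<in>B. c b = 0))"

text \<open>The supremum is taken in \<open>enat\<close> because in \<open>nat\<close> it would be meaningless for a group of
  infinite rank.\<close>

definition abelian_rank :: "('a, 'b) monoid_scheme \<Rightarrow> enat" where
  "abelian_rank G = (SUP B\<in>{B. int_independent G B}. enat (card B))"

end

theory Submission
  imports Defs
begin

text \<open>The chains of \<open>P\<close> with rank difference at most \<open>k\<close> filter the order complex, and the \<open>k\<close>-th
  quotient of the filtration is exactly the magnitude complex of length \<open>k\<close>. If the magnitude
  homology is diagonal, adding the chains with rank difference \<open>k + 1\<close> leaves homology in degrees
  below \<open>k\<close> unchanged. Chains with rank difference less than \<open>k\<close> have dimension less than \<open>k\<close>, so the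
  top homology group consists of cycles and embeds in the group of magnitude cycles of degree \<open>k\<close>.
  By exactness below degree \<open>k\<close>, the rank of the latter is, up to sign, the Euler characteristic of
  the magnitude complex of length \<open>k\<close>, which is a sum of values of \<open>\<mu>\<close> by Philip Hall's theorem.\<close>

section \<open>Rank of subgroups of free abelian groups\<close>

text \<open>In degree \<open>i\<close> the inclusion of one stage of the filtration into the next
  induces an isomorphism if the quotient is exact in degrees \<open>i\<close> and
  \<open>i + 1\<close>. The quotient that adds rank difference \<open>k + 1\<close> may have
  homology in degree \<open>k + 1\<close>, so this argument reaches \<open>i < k\<close> and stops
  at \<open>i = k\<close>, where only a bound on the rank remains. Ranks are counted over the
  integers. A maximal independent set in a group of chains need not generate the group, only a
  nonzero multiple of each element; rank-nullity is therefore proved with denominators cleared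
  throughout. The rank of the magnitude cycles is a signed sum of values of \<mu>, and the triangle
  inequality puts the absolute values inside the sum.\<close>

abbreviation chains_on :: "'b set \<Rightarrow> ('b \<Rightarrow>\<^sub>0 int) set" where
  "chains_on S \<equiv> carrier (free_Abelian_group S)"

lemma additive_frag_extend: "additive (frag_extend f)"
  by (simp add: additive_def frag_extend_add)

lemma additive_frag_cmul:
  assumes "additive h"
  shows "h (frag_cmul n x) = frag_cmul n (h x)"
proof -
  interpret additive h by fact
  have nat: "h (frag_cmul (int n) x) = frag_cmul (int n) (h x)" for n
    by (induction n) (simp_all add: zero frag_cmul_distrib add)
  show ?thesis
  proof (cases n)
    case (nonneg m)
    then show ?thesis using nat by simp
  next
    case (neg m)
    have "h (frag_cmul n x) = h (- frag_cmul (int (Suc m)) x)"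
      using neg by (simp only: minus_frag_cmul)
    also have "\<dots> = - frag_cmul (int (Suc m)) (h x)"
      by (simp only: minus nat)
    finally show ?thesis using neg by (simp only: minus_frag_cmul)
  qed
qed

lemma additive_frag_combination:
  assumes "additive h"
  shows "h (\<Sum>x\<in>I. frag_cmul (c x) (f x)) = (\<Sum>x\<in>I. frag_cmul (c x) (h (f x)))"
  by (simp add: additive.sum[OF assms] additive_frag_cmul[OF assms])

lemma frag_cmul_in_chains: "x \<in> chains_on S \<Longrightarrow> frag_cmul n x \<in> chains_on S"
  using keys_cmul by fastforce

lemma add_in_chains: "x \<in> chains_on S \<Longrightarrow> y \<in> chains_on S \<Longrightarrow> x + y \<in> chains_on S"
  using keys_add[of x y] by auto

lemma diff_in_chains: "x \<in> chains_on S \<Longrightarrow> y \<in> chains_on S \<Longrightarrow> x - y \<in> chains_on S"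
  using keys_diff[of x y] by auto

section \<open>Linear independence over the integers\<close>

definition frag_independent :: "('b \<Rightarrow>\<^sub>0 int) set \<Rightarrow> bool" where
  "frag_independent B \<longleftrightarrow>
     finite B \<and> (\<forall>c. (\<Sum>b\<in>B. frag_cmul (c b) b) = 0 \<longrightarrow> (\<forall>b\<in>B. c b = 0))"

text \<open>Gaussian elimination: a coordinate \<open>s\<close> is cleared with a vector \<open>f t\<^sub>0\<close> that does not vanish
  there.\<close>

lemma independent_family_card_le:
  fixes f :: "'t \<Rightarrow> 'b \<Rightarrow>\<^sub>0 int"
  assumes "finite S" and "finite T" and "\<And>t. t \<in> T \<Longrightarrow> f t \<in> chains_on S"
    and "\<And>c. (\<Sum>t\<in>T. frag_cmul (c t) (f t)) = 0 \<Longrightarrow> \<forall>t\<in>T. c t = 0"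
  shows "card T \<le> card S"
  using assms
proof (induction S arbitrary: T f rule: finite_induct)
  case empty
  \<comment> \<open>All \<open>f t\<close> vanish, so the coefficients 1 form a relation, which is
    possible only for empty \<open>T\<close>.\<close>
  then have "(\<Sum>t\<in>T. frag_cmul 1 (f t)) = 0"
    by (intro sum.neutral) auto
  then have "T = {}"
    using empty.prems(3)[of "\<lambda>_. 1"] by auto
  then show ?case by simp
next
  case (insert s S)
  show ?case
  proof (cases "\<forall>t\<in>T. Poly_Mapping.lookup (f t) s = 0")
    case True
    then have "f t \<in> chains_on S" if "t \<in> T" for t
      using insert.prems(2)[OF that] that by (auto simp: in_keys_iff)
    then have "card T \<le> card S"
      using insert.IH insert.prems by blast
    then show ?thesis using insert.hyps by simp
  next
    case False
    then obtain t0 where t0: "t0 \<in> T" "Poly_Mapping.lookup (f t0) s \<noteq> 0" by blast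
    define a where "a = Poly_Mapping.lookup (f t0) s"
    define g where "g t = frag_cmul a (f t) - frag_cmul (Poly_Mapping.lookup (f t) s) (f t0)" for t
    have fin: "finite (T - {t0})" using insert.prems by simp
    have "card (T - {t0}) \<le> card S"
    proof (rule insert.IH[OF fin])
      fix t assume t: "t \<in> T - {t0}"
      have "s \<notin> Poly_Mapping.keys (g t)"
        by (simp add: g_def a_def in_keys_iff lookup_minus)
      moreover have "g t \<in> chains_on (insert s S)"
        unfolding g_def using t t0(1) by (intro diff_in_chains frag_cmul_in_chains insert.prems(2)) auto
      ultimately show "g t \<in> chains_on S" by auto
    next
      fix c assume c: "(\<Sum>t\<in>T - {t0}. frag_cmul (c t) (g t)) = 0"
      \<comment> \<open>Expanding the relation among the \<open>g t\<close> in terms of the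
        \<open>f t\<close> gives these coefficients; that of \<open>f t0\<close> collects everything
        subtracted while clearing the coordinate \<open>s\<close>. Since \<open>a\<close> is
        nonzero, \<open>c t * a = 0\<close> gives back \<open>c t = 0\<close>.\<close>
      define c' where "c' t = (if t = t0 then - (\<Sum>t\<in>T - {t0}. c t * Poly_Mapping.lookup (f t) s) else c t * a)" for t
      have "(\<Sum>t\<in>T. frag_cmul (c' t) (f t))
          = frag_cmul (c' t0) (f t0) + (\<Sum>t\<in>T - {t0}. frag_cmul (c' t) (f t))"
        using insert.prems(1) t0(1) by (rule sum.remove)
      also have "(\<Sum>t\<in>T - {t0}. frag_cmul (c' t) (f t)) = (\<Sum>t\<in>T - {t0}. frag_cmul (c t * a) (f t))"
        by (rule sum.cong) (auto simp: c'_def)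
      also have "frag_cmul (c' t0) (f t0) + (\<Sum>t\<in>T - {t0}. frag_cmul (c t * a) (f t))
          = (\<Sum>t\<in>T - {t0}. frag_cmul (c t) (g t))"
        by (rule poly_mapping_eqI)
          (simp add: c'_def g_def lookup_add lookup_minus lookup_sum sum_distrib_right
            right_diff_distrib sum_subtractf mult.assoc)
      finally have "(\<Sum>t\<in>T. frag_cmul (c' t) (f t)) = 0" using c by simp
      from insert.prems(3)[OF this] show "\<forall>t\<in>T - {t0}. c t = 0"
        using t0(2) by (auto simp: c'_def a_def split: if_splits)
    qed
    then show ?thesis
      using insert.prems(1) insert.hyps t0(1) by (simp add: card_Diff_singleton)
  qed
qed

lemma frag_independent_card_le:
  assumes "finite S" "B \<subseteq> chains_on S" "frag_independent B"
  shows "card B \<le> card S"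
proof (rule independent_family_card_le[where f = "\<lambda>b. b"])
  show "b \<in> chains_on S" if "b \<in> B" for b using assms(2) that by blast
qed (use assms in \<open>auto simp: frag_independent_def\<close>)

lemma zero_notin_frag_independent: "frag_independent B \<Longrightarrow> 0 \<notin> B"
proof
  assume B: "frag_independent B" "0 \<in> B"
  have "(\<Sum>b\<in>B. frag_cmul (if b = 0 then 1 else 0) b) = 0"
    by (rule sum.neutral) auto
  then have "\<forall>b\<in>B. (if b = 0 then 1 else 0 :: int) = 0"
    using B(1)[unfolded frag_independent_def, THEN conjunct2, rule_format, of "\<lambda>b. if b = 0 then 1 else 0"]
    by blast
  with B(2) show False by auto
qed

text \<open>\<open>Max\<close> is meaningful here because \<open>A\<close> will always lie in the
  chains on a finite basis, which bounds the size of independent subsets.\<close>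

definition frag_rank :: "('b \<Rightarrow>\<^sub>0 int) set \<Rightarrow> nat" where
  "frag_rank A = Max {card B | B. B \<subseteq> A \<and> frag_independent B}"

lemma
  assumes "finite S" and "A \<subseteq> chains_on S"
  shows finite_independent_cards: "finite {card B | B. B \<subseteq> A \<and> frag_independent B}"
    and independent_cards_nonempty: "{card B | B. B \<subseteq> A \<and> frag_independent B} \<noteq> {}"
proof -
  have "{card B | B. B \<subseteq> A \<and> frag_independent B} \<subseteq> {..card S}"
    using frag_independent_card_le[OF assms(1)] assms(2) by auto
  then show "finite {card B | B. B \<subseteq> A \<and> frag_independent B}"
    using finite_subset by blast
  have "frag_independent ({} :: ('a \<Rightarrow>\<^sub>0 int) set)" by (simp add: frag_independent_def)
  then show "{card B | B. B \<subseteq> A \<and> frag_independent B} \<noteq> {}"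
    by blast
qed

lemma frag_independent_card_le_rank:
  assumes "finite S" "A \<subseteq> chains_on S" "B \<subseteq> A" "frag_independent B"
  shows "card B \<le> frag_rank A"
  unfolding frag_rank_def using assms finite_independent_cards[OF assms(1,2)]
  by (intro Max_ge) auto

lemma frag_rank_basis:
  assumes "finite S" "A \<subseteq> chains_on S"
  obtains B where "B \<subseteq> A" "frag_independent B" "card B = frag_rank A"
  using Max_in[OF finite_independent_cards[OF assms] independent_cards_nonempty[OF assms]]
  unfolding frag_rank_def by auto

lemma frag_rank_mono:
  assumes "finite S" "A' \<subseteq> chains_on S" "A \<subseteq> A'"
  shows "frag_rank A \<le> frag_rank A'"
proof -
  obtain B where "B \<subseteq> A" "frag_independent B" "card B = frag_rank A"
    using frag_rank_basis[of S A] assms by blast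
  then show ?thesis
    using frag_independent_card_le_rank[of S A' B] assms by auto
qed

text \<open>Integral substitute for spanning: by maximality \<open>insert x B\<close> is dependent,
  and the coefficient of \<open>x\<close> in a nontrivial relation is nonzero because
  \<open>B\<close> itself is independent.\<close>

lemma frag_rank_basis_multiple:
  assumes "finite S" "A \<subseteq> chains_on S"
    and B: "B \<subseteq> A" "frag_independent B" "card B = frag_rank A" and x: "x \<in> A"
  obtains n c where "n \<noteq> 0" "frag_cmul n x = (\<Sum>b\<in>B. frag_cmul (c b) b)"
proof (cases "x \<in> B")
  case True
  have "(\<Sum>b\<in>B. frag_cmul (if b = x then 1 else 0) b) = (\<Sum>b\<in>B. if x = b then b else 0)"
    by (intro sum.cong) auto
  also have "\<dots> = frag_cmul 1 x"
    using B(2) True by (simp add: frag_independent_def)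
  finally show ?thesis
    using that[of 1 "\<lambda>b. if b = x then 1 else 0"] by simp
next
  case False
  have fin: "finite B" using B by (simp add: frag_independent_def)
  have "\<not> frag_independent (insert x B)"
    using frag_independent_card_le_rank[OF assms(1,2), of "insert x B"] B x False fin by auto
  then obtain c where c: "(\<Sum>b\<in>insert x B. frag_cmul (c b) b) = 0" "\<exists>b\<in>insert x B. c b \<noteq> 0"
    using fin by (auto simp: frag_independent_def)
  have eq: "frag_cmul (c x) x + (\<Sum>b\<in>B. frag_cmul (c b) b) = 0"
    using c(1) fin False by simp
  have "c x \<noteq> 0"
  proof
    assume cx: "c x = 0"
    with eq B(2) have "\<forall>b\<in>B. c b = 0" by (simp add: frag_independent_def)
    with c(2) cx show False by auto
  qed
  moreover have "frag_cmul (c x) x = (\<Sum>b\<in>B. frag_cmul (- c b) b)"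
    using eq by (simp add: eq_neg_iff_add_eq_0 sum_negf flip: minus_frag_cmul)
  ultimately show ?thesis
    using that[of "c x" "\<lambda>b. - c b"] by simp
qed

text \<open>A Steinitz bound for spanning up to nonzero multiples. Each element of \<open>L\<close>
  is replaced by its formal coordinate vector over \<open>J\<close>;
  \<open>frag_extend (\<lambda>x. x)\<close> evaluates such a vector, so a relation among the
  vectors becomes a relation in \<open>L\<close>.\<close>

lemma frag_independent_exchange:
  assumes L: "frag_independent L" and J: "finite J"
    and "\<And>x. x \<in> L \<Longrightarrow> \<exists>n c. n \<noteq> 0 \<and> frag_cmul n x = (\<Sum>j\<in>J. frag_cmul (c j) j)"
  shows "card L \<le> card J"
proof -
  obtain n c where nc: "\<And>x. x \<in> L \<Longrightarrow> n x \<noteq> 0"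
      "\<And>x. x \<in> L \<Longrightarrow> frag_cmul (n x) x = (\<Sum>j\<in>J. frag_cmul (c x j) j)"
    using assms(3) by metis
  define f where "f x = (\<Sum>j\<in>J. frag_cmul (c x j) (frag_of j))" for x
  show ?thesis
  proof (rule independent_family_card_le[OF J, where f = f])
    show "finite L" using L by (simp add: frag_independent_def)
    show "f x \<in> chains_on J" for x
      unfolding f_def by (rule sum_closed_free_Abelian_group) auto
    fix a assume "(\<Sum>x\<in>L. frag_cmul (a x) (f x)) = 0"
    then have "frag_extend (\<lambda>x. x) (\<Sum>x\<in>L. frag_cmul (a x) (f x)) = 0"
      by simp
    then have "(\<Sum>x\<in>L. frag_cmul (a x) (frag_cmul (n x) x)) = 0"
      by (simp add: additive_frag_combination[OF additive_frag_extend] f_def nc(2))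
    then have "\<forall>x\<in>L. a x * n x = 0"
      using L[unfolded frag_independent_def, THEN conjunct2, rule_format, of "\<lambda>x. a x * n x"] by simp
    then show "\<forall>x\<in>L. a x = 0" using nc(1) by auto
  qed
qed

lemma frag_rank_chains:
  assumes "finite S"
  shows "frag_rank (chains_on S) = card S"
proof (rule antisym)
  obtain B where "B \<subseteq> chains_on S" "frag_independent B" "card B = frag_rank (chains_on S)"
    using frag_rank_basis[OF assms order_refl] .
  then show "frag_rank (chains_on S) \<le> card S"
    using frag_independent_card_le[OF assms] by metis
  have inj: "inj_on frag_of S" by (simp add: inj_on_def frag_of_eq)
  have "frag_independent (frag_of ` S)"
    unfolding frag_independent_def
  proof (intro conjI allI impI ballI)
    show "finite (frag_of ` S)" using assms by simp
    fix c :: "('a \<Rightarrow>\<^sub>0 int) \<Rightarrow> int" and b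
    assume "(\<Sum>b\<in>frag_of ` S. frag_cmul (c b) b) = 0" and "b \<in> frag_of ` S"
    then obtain s where s: "s \<in> S" "b = frag_of s"
      and 0: "(\<Sum>s\<in>S. frag_cmul (c (frag_of s)) (frag_of s)) = 0"
      by (auto simp: sum.reindex[OF inj])
    have "0 = Poly_Mapping.lookup (\<Sum>s\<in>S. frag_cmul (c (frag_of s)) (frag_of s)) s"
      by (simp add: 0)
    also have "\<dots> = (\<Sum>x\<in>S. if s = x then c (frag_of x) else 0)"
      unfolding lookup_sum by (rule sum.cong) simp_all
    also have "\<dots> = c b"
      using assms s by simp
    finally show "c b = 0" by simp
  qed
  then have "card (frag_of ` S) \<le> frag_rank (chains_on S)"
    by (intro frag_independent_card_le_rank[OF assms order_refl]) (auto simp: image_subset_iff)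
  then show "card S \<le> frag_rank (chains_on S)"
    by (simp add: card_image[OF inj])
qed

text \<open>Rank-nullity: a maximal independent set \<open>K\<close> of the kernel together with
  lifts of a maximal independent set \<open>I\<close> of the image is independent, since
  \<open>h\<close> kills \<open>K\<close>, and it spans up to nonzero multiples, with denominators
  cleared once in the image and once in the kernel.\<close>

lemma frag_rank_kernel_image:
  assumes S: "finite S" and T: "finite T" and h: "additive h"
    and hST: "\<And>x. x \<in> chains_on S \<Longrightarrow> h x \<in> chains_on T"
  shows "frag_rank (chains_on S) = frag_rank {x \<in> chains_on S. h x = 0} + frag_rank (h ` chains_on S)"
proof -
  interpret h: additive h by fact
  let ?Z = "{x \<in> chains_on S. h x = 0}"
  have sub: "?Z \<subseteq> chains_on S" "h ` chains_on S \<subseteq> chains_on T" using hST by auto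
  obtain K where K: "K \<subseteq> ?Z" "frag_independent K" "card K = frag_rank ?Z"
    using frag_rank_basis[OF S sub(1)] .
  obtain I where I: "I \<subseteq> h ` chains_on S" "frag_independent I" "card I = frag_rank (h ` chains_on S)"
    using frag_rank_basis[OF T sub(2)] .
  have "\<forall>y\<in>I. \<exists>x. x \<in> chains_on S \<and> h x = y" using I(1) by blast
  then obtain l where l: "\<And>y. y \<in> I \<Longrightarrow> l y \<in> chains_on S" "\<And>y. y \<in> I \<Longrightarrow> h (l y) = y"
    by metis
  have inj: "inj_on l I" using l(2) by (metis inj_onI)
  have fin: "finite K" "finite (l ` I)" using K(2) I(2) by (auto simp: frag_independent_def)
  \<comment> \<open>\<open>h\<close> is zero on \<open>K\<close> but sends \<open>l y\<close> to
    \<open>y\<close>, and an independent set does not contain 0.\<close>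
  have disj: "K \<inter> l ` I = {}"
    using K(1) l zero_notin_frag_independent[OF I(2)] by auto
  have split: "(\<Sum>b\<in>K \<union> l ` I. frag_cmul (c b) b)
      = (\<Sum>b\<in>K. frag_cmul (c b) b) + (\<Sum>y\<in>I. frag_cmul (c (l y)) (l y))" for c
    by (simp add: sum.union_disjoint[OF fin disj] sum.reindex[OF inj])
  have hK: "h (\<Sum>b\<in>K. frag_cmul (c b) b) = 0" for c
    unfolding additive_frag_combination[OF h] using K(1) by (intro sum.neutral) auto
  have hI: "h (\<Sum>y\<in>I. frag_cmul (c y) (l y)) = (\<Sum>y\<in>I. frag_cmul (c y) y)" for c
    by (simp add: additive_frag_combination[OF h] l(2))
  have card: "card (K \<union> l ` I) = frag_rank ?Z + frag_rank (h ` chains_on S)"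
    by (simp add: card_Un_disjoint[OF fin disj] K(3) I(3) card_image[OF inj])
  have "frag_independent (K \<union> l ` I)"
    unfolding frag_independent_def
  proof (intro conjI allI impI)
    show "finite (K \<union> l ` I)" using fin by simp
    fix c assume "(\<Sum>b\<in>K \<union> l ` I. frag_cmul (c b) b) = 0"
    then have c: "(\<Sum>b\<in>K. frag_cmul (c b) b) + (\<Sum>y\<in>I. frag_cmul (c (l y)) (l y)) = 0"
      by (simp only: split)
    then have "h ((\<Sum>b\<in>K. frag_cmul (c b) b) + (\<Sum>y\<in>I. frag_cmul (c (l y)) (l y))) = 0"
      by (simp add: h.zero)
    then have "(\<Sum>y\<in>I. frag_cmul (c (l y)) y) = 0"
      by (simp add: h.add hK hI)
    then have cI: "\<forall>y\<in>I. c (l y) = 0"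
      using I(2)[unfolded frag_independent_def, THEN conjunct2, rule_format, of "\<lambda>y. c (l y)"] by simp
    then have "(\<Sum>b\<in>K. frag_cmul (c b) b) = 0" using c by simp
    then have "\<forall>b\<in>K. c b = 0" using K(2) by (simp add: frag_independent_def)
    then show "\<forall>b\<in>K \<union> l ` I. c b = 0" using cI by auto
  qed
  then have ge: "card (K \<union> l ` I) \<le> frag_rank (chains_on S)"
    using K(1) l(1) by (intro frag_independent_card_le_rank[OF S order_refl]) auto
  obtain L where L: "L \<subseteq> chains_on S" "frag_independent L" "card L = frag_rank (chains_on S)"
    using frag_rank_basis[OF S order_refl] .
  have "card L \<le> card (K \<union> l ` I)"
  proof (rule frag_independent_exchange[OF L(2)])
    show "finite (K \<union> l ` I)" using fin by simp
    fix x assume "x \<in> L"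
    then have x: "x \<in> chains_on S" using L by blast
    obtain n c where n: "n \<noteq> 0" and c: "frag_cmul n (h x) = (\<Sum>y\<in>I. frag_cmul (c y) y)"
      using frag_rank_basis_multiple[OF T sub(2) I, of "h x"] x by blast
    let ?s = "\<Sum>y\<in>I. frag_cmul (c y) (l y)"
    have "?s \<in> chains_on S"
      by (rule sum_closed_free_Abelian_group) (rule frag_cmul_in_chains[OF l(1)])
    moreover have "frag_cmul n x \<in> chains_on S" by (rule frag_cmul_in_chains[OF x])
    ultimately have "frag_cmul n x - ?s \<in> chains_on S"
      by (rule diff_in_chains[rotated])
    moreover have "h (frag_cmul n x - ?s) = 0"
      by (simp add: h.diff hI c additive_frag_cmul[OF h])
    ultimately obtain m e where m: "m \<noteq> 0"
      and e: "frag_cmul m (frag_cmul n x - ?s) = (\<Sum>b\<in>K. frag_cmul (e b) b)"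
      using frag_rank_basis_multiple[OF S sub(1) K, of "frag_cmul n x - ?s"] by blast
    \<comment> \<open>On a lift \<open>l y\<close> the map \<open>h\<close> recovers
      \<open>y\<close>, so the second branch is the coefficient \<open>m * c y\<close>
      there.\<close>
    define f where "f b = (if b \<in> K then e b else m * c (h b))" for b
    have fK: "(\<Sum>b\<in>K. frag_cmul (f b) b) = (\<Sum>b\<in>K. frag_cmul (e b) b)"
      by (rule sum.cong) (simp_all add: f_def)
    have fI: "(\<Sum>y\<in>I. frag_cmul (f (l y)) (l y)) = frag_cmul m ?s"
      unfolding frag_cmul_sum
    proof (rule sum.cong)
      fix y assume "y \<in> I"
      then have "f (l y) = m * c y"
        using disj l(2) by (auto simp: f_def)
      then show "frag_cmul (f (l y)) (l y) = frag_cmul m (frag_cmul (c y) (l y))"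
        by simp
    qed simp
    have "frag_cmul (m * n) x = frag_cmul m (frag_cmul n x - ?s) + frag_cmul m ?s"
      by (rule poly_mapping_eqI) (simp add: lookup_minus lookup_add right_diff_distrib)
    also have "\<dots> = (\<Sum>b\<in>K. frag_cmul (f b) b) + (\<Sum>y\<in>I. frag_cmul (f (l y)) (l y))"
      by (simp only: e fK fI)
    also have "\<dots> = (\<Sum>b\<in>K \<union> l ` I. frag_cmul (f b) b)"
      by (simp only: split)
    finally show "\<exists>n c. n \<noteq> 0 \<and> frag_cmul n x = (\<Sum>j\<in>K \<union> l ` I. frag_cmul (c j) j)"
      using m n by (metis mult_eq_0_iff)
  qed
  then show ?thesis using ge card L(3) by simp
qed

section \<open>Complexes of free abelian groups\<close>

text \<open>\<open>d\<close> acts on all integer combinations, and the laws are required only on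
  chains of \<open>S\<close>; thus a complex and a subcomplex can share the same boundary
  map.\<close>

locale based_complex =
  fixes S :: "nat \<Rightarrow> 'b set" and d :: "nat \<Rightarrow> ('b \<Rightarrow>\<^sub>0 int) \<Rightarrow> ('b \<Rightarrow>\<^sub>0 int)"
  assumes additive_d: "additive (d m)"
    and d_0: "d 0 c = 0"
    and d_closed: "c \<in> chains_on (S (Suc m)) \<Longrightarrow> d (Suc m) c \<in> chains_on (S m)"
    and d_d: "c \<in> chains_on (S (Suc m)) \<Longrightarrow> d m (d (Suc m) c) = 0"
begin

lemmas d_zero = additive.zero[OF additive_d]
  and d_add = additive.add[OF additive_d]
  and d_diff = additive.diff[OF additive_d]
  and d_minus = additive.minus[OF additive_d]

definition cycles :: "nat \<Rightarrow> ('b \<Rightarrow>\<^sub>0 int) set" where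
  "cycles m = {c \<in> chains_on (S m). d m c = 0}"

definition boundaries :: "nat \<Rightarrow> ('b \<Rightarrow>\<^sub>0 int) set" where
  "boundaries m = d (Suc m) ` chains_on (S (Suc m))"

definition cycle_group :: "nat \<Rightarrow> ('b \<Rightarrow>\<^sub>0 int) monoid" where
  "cycle_group m = subgroup_generated (free_Abelian_group (S m)) (cycles m)"

lemma boundaries_subset_cycles: "boundaries m \<subseteq> cycles m"
  unfolding boundaries_def cycles_def using d_closed d_d by blast

lemma subgroup_cycles: "subgroup (cycles m) (free_Abelian_group (S m))"
proof (rule group.subgroupI[OF group_free_Abelian_group])
  show "cycles m \<subseteq> chains_on (S m)" by (auto simp: cycles_def)
  show "cycles m \<noteq> {}" using d_zero by (auto simp: cycles_def intro!: exI[of _ 0])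
next
  fix a assume "a \<in> cycles m"
  then show "inv\<^bsub>free_Abelian_group (S m)\<^esub> a \<in> cycles m"
    by (auto simp: cycles_def d_minus)
next
  fix a b assume "a \<in> cycles m" "b \<in> cycles m"
  then show "a \<otimes>\<^bsub>free_Abelian_group (S m)\<^esub> b \<in> cycles m"
    using add_in_chains[of a "S m" b] by (simp add: cycles_def d_add)
qed

lemma carrier_cycle_group [simp]: "carrier (cycle_group m) = cycles m"
  by (simp add: cycle_group_def subgroup.carrier_subgroup_generated_subgroup subgroup_cycles)

lemma cycle_group_simps [simp]:
  "\<one>\<^bsub>cycle_group m\<^esub> = 0" "x \<otimes>\<^bsub>cycle_group m\<^esub> y = x + y"
  by (simp_all add: cycle_group_def)

lemma comm_group_cycle_group: "comm_group (cycle_group m)"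
  unfolding cycle_group_def
  by (rule group.abelian_subgroup_generated[OF group_free_Abelian_group abelian_free_Abelian_group])

lemma group_cycle_group: "group (cycle_group m)"
  using comm_group_cycle_group by (rule comm_group.axioms)

lemma complex_homology_eq: "complex_homology S d m = cycle_group m Mod boundaries m"
  by (simp add: complex_homology_def cycle_group_def cycles_def boundaries_def)

lemma diff_in_boundaries: "a \<in> boundaries m \<Longrightarrow> b \<in> boundaries m \<Longrightarrow> a - b \<in> boundaries m"
  unfolding boundaries_def by (force simp: d_diff[symmetric] intro: diff_in_chains)

lemma subgroup_boundaries: "subgroup (boundaries m) (cycle_group m)"
proof (rule group.subgroupI[OF group_cycle_group])
  have 0: "0 \<in> boundaries m"
    unfolding boundaries_def by (rule image_eqI[of _ _ 0]) (simp_all add: d_zero)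
  show "boundaries m \<subseteq> carrier (cycle_group m)" by (simp add: boundaries_subset_cycles)
  show "boundaries m \<noteq> {}" using 0 by blast
  have minus: "- a \<in> boundaries m" if "a \<in> boundaries m" for a
    using diff_in_boundaries[OF 0 that] by simp
  fix a assume a: "a \<in> boundaries m"
  then have "a \<in> cycles m" using boundaries_subset_cycles by blast
  then have "inv\<^bsub>cycle_group m\<^esub> a = - a"
    by (intro group.inv_equality[OF group_cycle_group])
      (auto simp: cycles_def d_minus)
  with minus a show "inv\<^bsub>cycle_group m\<^esub> a \<in> boundaries m" by simp
  fix b assume "b \<in> boundaries m"
  with minus have "a - (- b) \<in> boundaries m" by (intro diff_in_boundaries a)
  then show "a \<otimes>\<^bsub>cycle_group m\<^esub> b \<in> boundaries m" by simp
qed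

lemma normal_boundaries: "boundaries m \<lhd> cycle_group m"
  by (simp add: comm_group.normal_iff_subgroup comm_group_cycle_group subgroup_boundaries)

text \<open>A trivial factor group has only one coset, and every cycle lies in its own
  coset.\<close>

lemma trivial_homologyD:
  assumes "trivial_group (complex_homology S d m)"
  shows "cycles m = boundaries m"
proof
  show "cycles m \<subseteq> boundaries m"
  proof
    fix c assume c: "c \<in> cycles m"
    then have "boundaries m #>\<^bsub>cycle_group m\<^esub> c = boundaries m"
      using assms by (auto simp: trivial_group_def complex_homology_eq carrier_FactGroup)
    moreover have "c \<in> boundaries m #>\<^bsub>cycle_group m\<^esub> c"
      using c by (intro group.rcos_self[OF group_cycle_group _ subgroup_boundaries]) simp
    ultimately show "c \<in> boundaries m" by simp
  qed
qed (rule boundaries_subset_cycles)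

section \<open>Ranks of cycle groups and of homology\<close>

lemma rank_cycles_Suc:
  assumes "\<And>m. finite (S m)" and "cycles m = boundaries m"
  shows "card (S (Suc m)) = frag_rank (cycles (Suc m)) + frag_rank (cycles m)"
proof -
  have "frag_rank (chains_on (S (Suc m))) = frag_rank (cycles (Suc m)) + frag_rank (boundaries m)"
    unfolding cycles_def boundaries_def
    by (rule frag_rank_kernel_image[OF assms(1) assms(1) additive_d d_closed])
  then show ?thesis by (simp add: frag_rank_chains assms)
qed

text \<open>Rank-nullity is iterated upwards from degree 0, where every chain is a cycle. The step
  to a degree uses exactness one degree lower, so nothing is asked of degree \<open>i\<close>
  itself.\<close>

lemma rank_cycles_exact:
  assumes fin: "\<And>m. finite (S m)" and "\<And>j. j < i \<Longrightarrow> cycles j = boundaries j"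
  shows "int (frag_rank (cycles i)) = (-1) ^ i * (\<Sum>j\<le>i. (-1) ^ j * int (card (S j)))"
  using assms(2)
proof (induction i)
  case 0
  have "cycles 0 = chains_on (S 0)" by (auto simp: cycles_def d_0)
  then show ?case by (simp add: frag_rank_chains fin)
next
  case (Suc i)
  have "int (card (S (Suc i))) = int (frag_rank (cycles (Suc i))) + int (frag_rank (cycles i))"
    using rank_cycles_Suc[OF fin, of i] Suc.prems[of i] by simp
  moreover have "int (frag_rank (cycles i)) = (-1) ^ i * (\<Sum>j\<le>i. (-1) ^ j * int (card (S j)))"
    using Suc by simp
  ultimately show ?case by (simp add: algebra_simps)
qed

text \<open>Without chains in degree \<open>m + 1\<close> the only boundary is 0, so homology
  classes are singletons. \<open>the_elem\<close> unwraps them and carries independence in the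
  factor group to independence of cycles.\<close>

lemma abelian_rank_homology_le:
  assumes "finite (S m)" and "S (Suc m) = {}"
  shows "abelian_rank (complex_homology S d m) \<le> enat (frag_rank (cycles m))"
proof -
  let ?Z = "cycle_group m"
  let ?H = "complex_homology S d m"
  have bd: "boundaries m = {0}"
    using assms(2) by (auto simp: boundaries_def d_zero)
  have comm: "comm_group ?H"
    unfolding complex_homology_eq
    by (rule comm_group.abelian_FactGroup[OF comm_group_cycle_group subgroup_boundaries])
  interpret H: comm_group ?H by (rule comm)
  have coset: "boundaries m #>\<^bsub>?Z\<^esub> z = {z}" for z
    by (auto simp: bd r_coset_def)
  have carrier: "carrier ?H = (\<lambda>z. {z}) ` cycles m"
    by (simp add: complex_homology_eq carrier_FactGroup coset)
  have mult: "{x} \<otimes>\<^bsub>?H\<^esub> {y} = {x + y}" for x y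
    by (auto simp: complex_homology_eq set_mult_def)
  have one: "\<one>\<^bsub>?H\<^esub> = {0}"
    by (simp add: complex_homology_eq bd)
  have hom: "(\<lambda>z. {z}) \<in> hom ?Z ?H"
    by (auto simp: hom_def carrier mult)
  interpret h: group_hom ?Z ?H "\<lambda>z. {z}"
    by (intro group_hom.intro group_hom_axioms.intro group_cycle_group H.is_group hom)
  have pow: "{z} [^]\<^bsub>?H\<^esub> n = {frag_cmul n z}" if "z \<in> cycles m" for z and n :: int
  proof -
    have "{z} [^]\<^bsub>?H\<^esub> n = {z [^]\<^bsub>?Z\<^esub> n}"
      using h.hom_int_pow[of z n] that by simp
    also have "z [^]\<^bsub>?Z\<^esub> n = frag_cmul n z"
      using that carrier_cycle_group[of m] unfolding cycle_group_def
      by (subst group.int_pow_subgroup_generated[OF group_free_Abelian_group])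
        (simp_all add: cycles_def)
    finally show ?thesis .
  qed
  have finprod: "finprod ?H (\<lambda>b. b [^]\<^bsub>?H\<^esub> c b) B = {\<Sum>b\<in>B. frag_cmul (c b) (the_elem b)}"
    if "finite B" "B \<subseteq> carrier ?H" for B and c :: "_ \<Rightarrow> int"
    using that
  proof (induction B rule: finite_induct)
    case empty
    then show ?case by (simp add: one)
  next
    case (insert b B)
    then obtain z where z: "z \<in> cycles m" "b = {z}" by (auto simp: carrier)
    have "finprod ?H (\<lambda>b. b [^]\<^bsub>?H\<^esub> c b) (insert b B)
        = b [^]\<^bsub>?H\<^esub> c b \<otimes>\<^bsub>?H\<^esub> finprod ?H (\<lambda>b. b [^]\<^bsub>?H\<^esub> c b) B"
      using insert by (intro H.finprod_insert) auto
    also have "\<dots> = {frag_cmul (c b) (the_elem b) + (\<Sum>b\<in>B. frag_cmul (c b) (the_elem b))}"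
      using insert z pow[OF z(1)] by (simp add: mult)
    finally show ?case using insert by simp
  qed
  have "card B \<le> frag_rank (cycles m)" if B: "int_independent ?H B" for B
  proof -
    have fin: "finite B" and sub: "B \<subseteq> carrier ?H"
      using B by (auto simp: int_independent_def)
    have inj: "inj_on the_elem B"
    proof (rule inj_onI)
      fix x y assume xy: "x \<in> B" "y \<in> B" "the_elem x = the_elem y"
      then obtain u v where "x = {u}" "y = {v}" using sub unfolding carrier by blast
      with xy(3) show "x = y" by simp
    qed
    have "frag_independent (the_elem ` B)"
      unfolding frag_independent_def
    proof (intro conjI allI impI)
      show "finite (the_elem ` B)" using fin by simp
      fix c assume "(\<Sum>b\<in>the_elem ` B. frag_cmul (c b) b) = 0"
      then have "(\<Sum>b\<in>B. frag_cmul (c (the_elem b)) (the_elem b)) = 0"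
        by (simp add: sum.reindex[OF inj])
      then have "finprod ?H (\<lambda>b. b [^]\<^bsub>?H\<^esub> c (the_elem b)) B = \<one>\<^bsub>?H\<^esub>"
        using finprod[OF fin sub, of "\<lambda>b. c (the_elem b)"] by (simp add: one)
      then show "\<forall>b\<in>the_elem ` B. c b = 0"
        using B[unfolded int_independent_def, THEN conjunct2, THEN conjunct2, rule_format,
            of "\<lambda>b. c (the_elem b)"] by blast
    qed
    moreover have "the_elem ` B \<subseteq> cycles m" using sub by (auto simp: carrier)
    moreover have "cycles m \<subseteq> chains_on (S m)" by (auto simp: cycles_def)
    ultimately have "card (the_elem ` B) \<le> frag_rank (cycles m)"
      using frag_independent_card_le_rank[OF assms(1)] by blast
    then show ?thesis by (simp add: card_image[OF inj])
  qed
  then show ?thesis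
    unfolding abelian_rank_def by (intro SUP_least) simp
qed

end

section \<open>Pairs of complexes and relative homology\<close>

text \<open>\<open>d'\<close> is the boundary of the quotient complex, written on the basis elements of \<open>S'\<close> that are
  not in \<open>S\<close>.\<close>

locale based_complex_pair = sub: based_complex S d + super: based_complex S' d
  for S S' :: "nat \<Rightarrow> 'b set" and d :: "nat \<Rightarrow> ('b \<Rightarrow>\<^sub>0 int) \<Rightarrow> ('b \<Rightarrow>\<^sub>0 int)" +
  fixes d' :: "nat \<Rightarrow> ('b \<Rightarrow>\<^sub>0 int) \<Rightarrow> ('b \<Rightarrow>\<^sub>0 int)"
  assumes subset: "S m \<subseteq> S' m"
    and additive_d': "additive (d' m)"
    and d'_0: "d' 0 c = 0"
    and d'_closed: "c \<in> chains_on (S' (Suc m) - S (Suc m)) \<Longrightarrow> d' (Suc m) c \<in> chains_on (S' m - S m)"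
    and d_d': "c \<in> chains_on (S' (Suc m) - S (Suc m)) \<Longrightarrow> d (Suc m) c - d' (Suc m) c \<in> chains_on (S m)"
begin

lemma chains_subset: "c \<in> chains_on (S m) \<Longrightarrow> c \<in> chains_on (S' m)"
  using subset by auto

lemma quotient_chains_subset: "c \<in> chains_on (S' m - S m) \<Longrightarrow> c \<in> chains_on (S' m)"
  by auto

lemma chains_disjoint: "c \<in> chains_on (S m) \<Longrightarrow> c \<in> chains_on (S' m - S m) \<Longrightarrow> c = 0"
  by (metis Diff_disjoint carrier_free_Abelian_group_iff inf.absorb_iff2 keys_eq_empty le_inf_iff subset_empty)

lemma chains_split:
  assumes "c \<in> chains_on (S' m)"
  obtains a b where "a \<in> chains_on (S m)" "b \<in> chains_on (S' m - S m)" "c = a + b"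
proof -
  have "Poly_Mapping.keys c \<subseteq> S m \<union> (S' m - S m)" using assms by auto
  then show ?thesis
    by (rule frag_split) (use that in auto)
qed

text \<open>\<open>d'\<close> agrees with \<open>d\<close> modulo chains on \<open>S\<close>, so
  \<open>d' (d' c)\<close> is a chain on \<open>S\<close> because \<open>d (d c) = 0\<close>. It is
  also a chain on the complement of \<open>S\<close>, hence zero.\<close>

sublocale quotient: based_complex "\<lambda>m. S' m - S m" d'
proof
  show "d' m (d' (Suc m) c) = 0" if c: "c \<in> chains_on (S' (Suc m) - S (Suc m))" for c m
  proof (cases m)
    case 0
    then show ?thesis by (simp add: d'_0)
  next
    case (Suc l)
    let ?e = "d' (Suc m) c"
    have e: "?e \<in> chains_on (S' (Suc l) - S (Suc l))"
      using d'_closed[OF c] Suc by simp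
    have low: "d (Suc m) c - ?e \<in> chains_on (S (Suc l))"
      using d_d'[OF c] Suc by simp
    have "d m (d (Suc m) c) = 0"
      by (rule super.d_d[OF quotient_chains_subset[OF c]])
    then have "d m ?e = - d (Suc l) (d (Suc m) c - ?e)"
      by (simp add: super.d_diff Suc)
    moreover have "d (Suc l) (d (Suc m) c - ?e) \<in> chains_on (S l)"
      by (rule sub.d_closed[OF low])
    ultimately have "d m ?e \<in> chains_on (S l)" by simp
    moreover have "d m ?e - d' m ?e \<in> chains_on (S l)"
      using d_d'[OF e] Suc by simp
    ultimately have "d m ?e - (d m ?e - d' m ?e) \<in> chains_on (S l)"
      by (rule diff_in_chains)
    then have "d' m ?e \<in> chains_on (S l)" by simp
    moreover have "d' m ?e \<in> chains_on (S' l - S l)"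
      using d'_closed[OF e] Suc by simp
    ultimately show ?thesis by (rule chains_disjoint)
  qed
qed (fact d'_0 d'_closed additive.add[OF additive_d'])+

lemma cycles_subset: "sub.cycles m \<subseteq> super.cycles m"
  using chains_subset by (auto simp: sub.cycles_def super.cycles_def)

lemma quotient_cycle_iff:
  assumes "b \<in> chains_on (S' (Suc m) - S (Suc m))"
  shows "b \<in> quotient.cycles (Suc m) \<longleftrightarrow> d (Suc m) b \<in> chains_on (S m)"
proof
  assume "b \<in> quotient.cycles (Suc m)"
  then show "d (Suc m) b \<in> chains_on (S m)"
    using d_d'[OF assms] by (simp add: quotient.cycles_def)
next
  assume "d (Suc m) b \<in> chains_on (S m)"
  from diff_in_chains[OF this d_d'[OF assms]]
  have "d' (Suc m) b \<in> chains_on (S m)" by simp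
  then have "d' (Suc m) b = 0"
    using d'_closed[OF assms] by (rule chains_disjoint)
  then show "b \<in> quotient.cycles (Suc m)"
    using assms by (simp add: quotient.cycles_def)
qed

lemma quotient_cycleI:
  assumes "b \<in> chains_on (S' m - S m)" and "\<And>l. m = Suc l \<Longrightarrow> d m b \<in> chains_on (S l)"
  shows "b \<in> quotient.cycles m"
  using assms by (cases m) (simp_all add: quotient_cycle_iff, simp add: quotient.cycles_def d'_0)

lemma quotient_boundaryE:
  assumes "b \<in> quotient.boundaries m"
  obtains e where "e \<in> chains_on (S' (Suc m))" "b - d (Suc m) e \<in> chains_on (S m)"
proof -
  obtain e where e: "e \<in> chains_on (S' (Suc m) - S (Suc m))" "b = d' (Suc m) e"
    using assms by (auto simp: quotient.boundaries_def)
  have "0 - (d (Suc m) e - b) \<in> chains_on (S m)"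
    unfolding e(2) by (rule diff_in_chains[OF _ d_d'[OF e(1)]]) simp
  then show ?thesis
    using that[of e] quotient_chains_subset[OF e(1)] by simp
qed

text \<open>The segment of the long exact sequence of the pair, as a direct diagram chase on the map
  induced by inclusion: exactness of the quotient in degree \<open>Suc m\<close> gives injectivity,
  in degree \<open>m\<close> surjectivity.\<close>

lemma homology_iso:
  assumes "quotient.cycles m = quotient.boundaries m"
    and "quotient.cycles (Suc m) = quotient.boundaries (Suc m)"
  shows "complex_homology S d m \<cong> complex_homology S' d m"
proof -
  let ?h = "\<lambda>z. super.boundaries m #>\<^bsub>super.cycle_group m\<^esub> z"
  have hom: "?h \<in> hom (sub.cycle_group m) (complex_homology S' d m)"
  proof (rule homI)
    fix x assume "x \<in> carrier (sub.cycle_group m)"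
    then show "?h x \<in> carrier (complex_homology S' d m)"
      using cycles_subset by (auto simp: super.complex_homology_eq carrier_FactGroup)
  next
    fix x y assume "x \<in> carrier (sub.cycle_group m)" "y \<in> carrier (sub.cycle_group m)"
    then have "x \<in> carrier (super.cycle_group m)" "y \<in> carrier (super.cycle_group m)"
      using cycles_subset by auto
    from normal.rcos_sum[OF super.normal_boundaries this]
    show "?h (x \<otimes>\<^bsub>sub.cycle_group m\<^esub> y) = ?h x \<otimes>\<^bsub>complex_homology S' d m\<^esub> ?h y"
      by (simp add: super.complex_homology_eq)
  qed
  interpret h: group_hom "sub.cycle_group m" "complex_homology S' d m" ?h
    unfolding super.complex_homology_eq
    by (intro group_hom.intro group_hom_axioms.intro sub.group_cycle_group
        normal.factorgroup_is_group[OF super.normal_boundaries]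
        hom[unfolded super.complex_homology_eq])
  have kernel: "kernel (sub.cycle_group m) (complex_homology S' d m) ?h = sub.boundaries m"
  proof -
    have "z \<in> sub.boundaries m" if z: "z \<in> sub.cycles m" "?h z = super.boundaries m" for z
    proof -
      have "z \<in> super.boundaries m"
        using group.rcos_self[OF super.group_cycle_group _ super.subgroup_boundaries, of z]
          z cycles_subset by auto
      then obtain c where c: "c \<in> chains_on (S' (Suc m))" "z = d (Suc m) c"
        by (auto simp: super.boundaries_def)
      obtain a b where ab: "a \<in> chains_on (S (Suc m))" "b \<in> chains_on (S' (Suc m) - S (Suc m))"
          "c = a + b"
        using chains_split[OF c(1)] .
      have "d (Suc m) b = z - d (Suc m) a"
        by (simp add: c(2) ab(3) super.d_add)
      also have "\<dots> \<in> chains_on (S m)"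
        using z(1) sub.d_closed[OF ab(1)] by (intro diff_in_chains) (simp_all add: sub.cycles_def)
      \<comment> \<open>The part of the bounding chain outside \<open>S\<close> has its boundary in
        \<open>S\<close>, so it is a relative cycle and hence a relative boundary.\<close>
      finally have "b \<in> quotient.boundaries (Suc m)"
        using quotient_cycle_iff[OF ab(2)] assms(2) by simp
      then obtain e where e: "e \<in> chains_on (S' (Suc (Suc m)))"
          "b - d (Suc (Suc m)) e \<in> chains_on (S (Suc m))"
        by (rule quotient_boundaryE)
      \<comment> \<open>Subtracting a boundary from the bounding chain leaves its image under
        \<open>d\<close> unchanged and moves the chain into \<open>S\<close>.\<close>
      have "z = d (Suc m) (a + (b - d (Suc (Suc m)) e))"
        by (simp add: c(2) ab(3) super.d_add super.d_diff super.d_d[OF e(1)])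
      then show ?thesis
        unfolding sub.boundaries_def using add_in_chains[OF ab(1) e(2)] by blast
    qed
    moreover have "?h z = super.boundaries m" if "z \<in> sub.boundaries m" for z
    proof -
      have "z \<in> super.boundaries m"
        using that chains_subset by (auto simp: sub.boundaries_def super.boundaries_def)
      then show ?thesis
        by (rule subgroup.rcos_const[OF super.subgroup_boundaries super.group_cycle_group])
    qed
    ultimately show ?thesis
      using sub.boundaries_subset_cycles[of m]
      by (auto simp: kernel_def super.complex_homology_eq)
  qed
  have onto: "?h ` carrier (sub.cycle_group m) = carrier (complex_homology S' d m)"
  proof
    show "carrier (complex_homology S' d m) \<subseteq> ?h ` carrier (sub.cycle_group m)"
    proof
      fix x assume "x \<in> carrier (complex_homology S' d m)"
      then obtain z where z: "z \<in> super.cycles m" "x = ?h z"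
        by (auto simp: super.complex_homology_eq carrier_FactGroup)
      then have "z \<in> chains_on (S' m)" by (simp add: super.cycles_def)
      then obtain a b where ab: "a \<in> chains_on (S m)" "b \<in> chains_on (S' m - S m)" "z = a + b"
        by (rule chains_split)
      have "b \<in> quotient.cycles m"
      proof (rule quotient_cycleI[OF ab(2)])
        fix l assume l: "m = Suc l"
        have "d m b = - d m a"
          using z(1) by (simp add: super.cycles_def ab(3) super.d_add eq_neg_iff_add_eq_0 add.commute)
        then show "d m b \<in> chains_on (S l)"
          using sub.d_closed[of a l] ab(1) l by simp
      qed
      then have "b \<in> quotient.boundaries m" using assms(1) by simp
      then obtain e where e: "e \<in> chains_on (S' (Suc m))" "b - d (Suc m) e \<in> chains_on (S m)"
        by (rule quotient_boundaryE)
      \<comment> \<open>The corrected cycle is homologous to \<open>z\<close> in the larger complex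
        and has no part outside \<open>S\<close>.\<close>
      have w: "z - d (Suc m) e \<in> sub.cycles m"
        using add_in_chains[OF ab(1) e(2)] z(1)
        by (simp add: sub.cycles_def super.cycles_def ab(3) super.d_diff super.d_d[OF e(1)] add_diff_eq)
      have de: "d (Suc m) e \<in> super.boundaries m"
        using e(1) by (auto simp: super.boundaries_def)
      have "?h z = ?h (d (Suc m) e) \<otimes>\<^bsub>complex_homology S' d m\<^esub> ?h (z - d (Suc m) e)"
      proof -
        have "d (Suc m) e \<in> carrier (super.cycle_group m)"
          "z - d (Suc m) e \<in> carrier (super.cycle_group m)"
          using de w super.boundaries_subset_cycles cycles_subset by auto
        from normal.rcos_sum[OF super.normal_boundaries this]
        show ?thesis by (simp add: super.complex_homology_eq)
      qed
      also have "?h (d (Suc m) e) = \<one>\<^bsub>complex_homology S' d m\<^esub>"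
        using subgroup.rcos_const[OF super.subgroup_boundaries super.group_cycle_group de]
        by (simp add: super.complex_homology_eq)
      also have "\<dots> \<otimes>\<^bsub>complex_homology S' d m\<^esub> ?h (z - d (Suc m) e) = ?h (z - d (Suc m) e)"
        using w by (intro h.H.l_one h.hom_closed) simp
      finally show "x \<in> ?h ` carrier (sub.cycle_group m)"
        using w z(2) by simp
    qed
  qed (use hom in \<open>auto simp: hom_def\<close>)
  show ?thesis
    using h.FactGroup_iso[OF onto] unfolding kernel sub.complex_homology_eq .
qed

end

section \<open>Simplicial chains on ordered simplices\<close>

lemma delete_nth_0 [simp]: "delete_nth 0 (x # xs) = xs"
  by (simp add: delete_nth_def)

lemma delete_nth_Suc [simp]: "delete_nth (Suc i) (x # xs) = x # delete_nth i xs"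
  by (simp add: delete_nth_def)

lemma length_delete_nth: "i < length xs \<Longrightarrow> length (delete_nth i xs) = length xs - 1"
  by (auto simp: delete_nth_def)

text \<open>The simplicial identity for face maps: once the entry at \<open>i\<close> is gone, the
  entry formerly at \<open>Suc j\<close> sits at \<open>j\<close>.\<close>

lemma delete_nth_delete_nth:
  "i \<le> j \<Longrightarrow> Suc j < length xs \<Longrightarrow>
     delete_nth j (delete_nth i xs) = delete_nth i (delete_nth (Suc j) xs)"
proof (induction xs arbitrary: i j)
  case (Cons x xs)
  show ?case
  proof (cases i)
    case 0
    with Cons.prems show ?thesis by (cases xs) simp_all
  next
    case (Suc i')
    with Cons.prems obtain j' where "j = Suc j'" by (cases j) auto
    then show ?thesis using Cons.IH[of i' j'] Cons.prems Suc by simp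
  qed
qed simp

lemma set_delete_nth: "set (delete_nth i xs) \<subseteq> set xs"
  by (auto simp: delete_nth_def dest: in_set_takeD in_set_dropD)

lemma sorted_wrt_delete_nth: "sorted_wrt R xs \<Longrightarrow> sorted_wrt R (delete_nth i xs)"
proof (induction xs arbitrary: i)
  case (Cons x xs)
  then show ?case using set_delete_nth[of _ xs] by (cases i) auto
qed (simp add: delete_nth_def)

lemma simplicial_boundary_0: "simplicial_boundary 0 c = 0"
  by (simp add: simplicial_boundary_def)

lemma additive_simplicial_boundary: "additive (simplicial_boundary m)"
  by (simp add: additive_def simplicial_boundary_def frag_extend_add)

lemma additive_magnitude_boundary: "additive (magnitude_boundary r k m)"
  by (simp add: additive_def magnitude_boundary_def frag_extend_add)

lemma simplicial_boundary_frag_of: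
  "simplicial_boundary (Suc m) (frag_of xs)
     = (\<Sum>i\<le>Suc m. frag_cmul ((-1) ^ i) (frag_of (delete_nth i xs)))"
  by (simp only: simplicial_boundary_def frag_extend_of nat.simps if_False)

text \<open>Reduces claims about additive maps to basis elements. With \<open>T = {}\<close> it
  proves that \<open>h\<close> vanishes, as 0 is the only chain on the empty basis.\<close>

lemma additive_in_chains:
  assumes "additive h" and "c \<in> chains_on S" and "\<And>x. x \<in> S \<Longrightarrow> h (frag_of x) \<in> chains_on T"
  shows "h c \<in> chains_on T"
proof -
  interpret h: additive h by fact
  have "Poly_Mapping.keys c \<subseteq> S" using assms(2) by simp
  then show ?thesis
  proof (induction c rule: frag_induction)
    case zero
    then show ?case by (simp add: h.zero)
  next
    case (one x)
    then show ?case by (rule assms(3))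
  next
    case (diff a b)
    then show ?case unfolding h.diff by (rule diff_in_chains)
  qed
qed

lemma boundary_boundary_frag_of:
  assumes "length xs = Suc (Suc m)"
  shows "simplicial_boundary m (simplicial_boundary (Suc m) (frag_of xs)) = 0"
proof (cases m)
  case 0
  then show ?thesis by (simp add: simplicial_boundary_0)
next
  case (Suc l)
  let ?t = "\<lambda>(i, j). frag_cmul ((-1) ^ (i + j)) (frag_of (delete_nth j (delete_nth i xs)))"
  let ?A = "{(i, j). i \<le> j \<and> j \<le> m}"
  let ?B = "{(i, j). j < i \<and> i \<le> Suc m}"
  have fin: "finite ?A" "finite ?B"
    by (rule finite_subset[of _ "{..Suc m} \<times> {..Suc m}"]; auto)+
  have "simplicial_boundary m (simplicial_boundary (Suc m) (frag_of xs))
      = (\<Sum>i\<le>Suc m. frag_cmul ((-1) ^ i) (simplicial_boundary m (frag_of (delete_nth i xs))))"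
    by (simp only: simplicial_boundary_frag_of
        additive_frag_combination[OF additive_simplicial_boundary])
  also have "\<dots> = (\<Sum>i\<le>Suc m. \<Sum>j\<le>m. ?t (i, j))"
    by (simp only: Suc simplicial_boundary_frag_of frag_cmul_sum frag_cmul_cmul power_add prod.case)
  also have "\<dots> = sum ?t ({..Suc m} \<times> {..m})"
    by (simp only: sum.cartesian_product case_prod_unfold prod.collapse)
  also have "{..Suc m} \<times> {..m} = ?A \<union> ?B" by auto
  also have "sum ?t (?A \<union> ?B) = sum ?t ?A + sum ?t ?B"
    by (rule sum.union_disjoint[OF fin]) auto
  \<comment> \<open>The pair \<open>(i, j)\<close> with \<open>i \<le> j\<close> removes the same
    two vertices as \<open>(Suc j, i)\<close>, whose exponent is larger by one; so the terms
    cancel.\<close>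
  also have "sum ?t ?A = (\<Sum>p\<in>?B. - ?t p)"
  proof (rule sum.reindex_bij_witness[of _ "\<lambda>(i, j). (j, i - 1)" "\<lambda>(i, j). (Suc j, i)"])
    fix p assume "p \<in> ?A"
    then obtain i j where p: "p = (i, j)" "i \<le> j" "j \<le> m" by auto
    have "delete_nth j (delete_nth i xs) = delete_nth i (delete_nth (Suc j) xs)"
      using p assms by (intro delete_nth_delete_nth) auto
    then show "- ?t (case p of (i, j) \<Rightarrow> (Suc j, i)) = ?t p"
      by (simp add: p(1) add.commute)
  qed auto
  also have "\<dots> + sum ?t ?B = 0" by (simp add: sum_negf)
  finally show ?thesis .
qed

lemma based_complex_simplicial:
  assumes "\<And>xs i. xs \<in> K \<Longrightarrow> i < length xs \<Longrightarrow> 2 \<le> length xs \<Longrightarrow> delete_nth i xs \<in> K"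
  shows "based_complex (\<lambda>m. {xs \<in> K. length xs = Suc m}) simplicial_boundary"
proof
  fix c :: "'a list \<Rightarrow>\<^sub>0 int" and m
  let ?S = "\<lambda>m. {xs \<in> K. length xs = Suc m}"
  assume c: "c \<in> chains_on (?S (Suc m))"
  show "simplicial_boundary (Suc m) c \<in> chains_on (?S m)"
  proof (rule additive_in_chains[OF additive_simplicial_boundary c])
    fix xs assume xs: "xs \<in> ?S (Suc m)"
    have "delete_nth i xs \<in> ?S m" if "i \<le> Suc m" for i
      using xs that assms[of xs i] by (simp add: length_delete_nth)
    then show "simplicial_boundary (Suc m) (frag_of xs) \<in> chains_on (?S m)"
      unfolding simplicial_boundary_frag_of
      by (intro sum_closed_free_Abelian_group frag_cmul_in_chains) simp
  qed
  have "simplicial_boundary m (simplicial_boundary (Suc m) c) \<in> chains_on {}"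
  proof (rule additive_in_chains[where h = "\<lambda>c. simplicial_boundary m (simplicial_boundary (Suc m) c)"])
    show "additive (\<lambda>c. simplicial_boundary m (simplicial_boundary (Suc m) c :: 'a list \<Rightarrow>\<^sub>0 int))"
      by (simp add: additive_def additive.add[OF additive_simplicial_boundary])
  qed (use c boundary_boundary_frag_of in auto)
  then show "simplicial_boundary m (simplicial_boundary (Suc m) c) = 0" by simp
qed (simp_all add: simplicial_boundary_0 additive.add[OF additive_simplicial_boundary])

section \<open>Chains of bounded rank difference\<close>

lemma tuple_length_single [simp]: "tuple_length r [x] = 0"
  by (simp add: tuple_length_def)

lemma tuple_length_Cons [simp]:
  "tuple_length r (x # y # zs) = rank_dist r x y + tuple_length r (y # zs)"
  by (simp add: tuple_length_def sum.lessThan_Suc_shift del: sum.lessThan_Suc)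

lemma sorted_less_hd_le:
  fixes xs :: "'a::order list"
  shows "sorted_wrt (<) xs \<Longrightarrow> y \<in> set xs \<Longrightarrow> hd xs \<le> y"
  by (cases xs) auto

lemma sorted_less_le_last:
  fixes xs :: "'a::order list"
  shows "sorted_wrt (<) xs \<Longrightarrow> y \<in> set xs \<Longrightarrow> y \<le> last xs"
  by (induction xs) (auto simp: less_imp_le)

text \<open>Strict monotonicity makes the truncated differences of ranks along a chain true ones and
  bounds the dimension of a chain by its rank difference.\<close>

locale ranked_poset =
  fixes P :: "'a::order set" and r :: "'a \<Rightarrow> nat"
  assumes finite_P: "finite P"
    and rank_less: "x \<in> P \<Longrightarrow> y \<in> P \<Longrightarrow> x < y \<Longrightarrow> r x < r y"
begin

lemma rank_le: "x \<in> P \<Longrightarrow> y \<in> P \<Longrightarrow> x \<le> y \<Longrightarrow> r x \<le> r y"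
  using rank_less[of x y] by (cases "x = y") (simp_all add: order.strict_iff_order)

lemma rank_hd_last:
  "sorted_wrt (<) xs \<Longrightarrow> set xs \<subseteq> P \<Longrightarrow> xs \<noteq> [] \<Longrightarrow> r (hd xs) + (length xs - 1) \<le> r (last xs)"
proof (induction xs rule: induct_list012)
  case (3 x y zs)
  then have "r x < r y" by (intro rank_less) auto
  with 3 show ?case by auto
qed auto

lemma tuple_length_sorted:
  "sorted_wrt (<) xs \<Longrightarrow> set xs \<subseteq> P \<Longrightarrow> xs \<noteq> [] \<Longrightarrow>
     tuple_length r xs = enat (r (last xs) - r (hd xs))"
proof (induction xs rule: induct_list012)
  case (3 x y zs)
  have "r x < r y" using 3 by (intro rank_less) auto
  moreover have "r y \<le> r (last (y # zs))"
    using rank_hd_last[of "y # zs"] 3 by auto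
  ultimately show ?case using 3 by (simp add: rank_dist_def less_imp_le)
qed (auto simp: zero_enat_def)

text \<open>A finite sum in \<open>enat\<close> has finite summands, so consecutive entries are
  comparable; being distinct, they increase strictly.\<close>

lemma sorted_if_tuple_length_finite:
  "tuple_length r xs = enat k \<Longrightarrow> \<forall>i<length xs - 1. xs ! i \<noteq> xs ! Suc i \<Longrightarrow> sorted_wrt (<) xs"
proof (induction xs arbitrary: k rule: induct_list012)
  case (3 x y zs)
  have "x \<le> y" using 3(3) by (auto simp: rank_dist_def split: if_splits)
  moreover have "x \<noteq> y" using 3(4) by (metis length_Cons diff_Suc_1 nth_Cons_0 nth_Cons_Suc zero_less_Suc)
  ultimately have "x < y" by simp
  obtain k' where "tuple_length r (y # zs) = enat k'"
    using 3(3) by (cases "tuple_length r (y # zs)") auto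
  moreover have "\<forall>i<length (y # zs) - 1. (y # zs) ! i \<noteq> (y # zs) ! Suc i"
    using 3(4) by (metis Suc_less_eq diff_Suc_1 length_Cons nth_Cons_Suc)
  ultimately have "sorted_wrt (<) (y # zs)" by (rule 3(2))
  with \<open>x < y\<close> show ?case by auto
qed auto

text \<open>The strict bound makes stage 0 empty, so that the magnitude complex of every length
  \<open>k\<close>, including 0, is the quotient of stage \<open>Suc k\<close> by stage
  \<open>k\<close>.\<close>

definition short_complex :: "nat \<Rightarrow> 'a list set" where
  "short_complex k = {xs \<in> order_complex P. r (last xs) - r (hd xs) < k}"

abbreviation short_basis :: "nat \<Rightarrow> nat \<Rightarrow> 'a list set" where
  "short_basis k m \<equiv> {xs \<in> short_complex k. length xs = Suc m}"

lemma short_complex_Suc: "short_complex (Suc k) = rank_order_complex P r k"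
  by (auto simp: short_complex_def rank_order_complex_def)

lemma magnitude_basis_eq:
  "magnitude_basis P r k m =
     {xs \<in> order_complex P. r (last xs) - r (hd xs) = k \<and> length xs = Suc m}"
proof (rule Set.set_eqI, rule iffI)
  fix xs assume xs: "xs \<in> magnitude_basis P r k m"
  then have "sorted_wrt (<) xs"
    by (intro sorted_if_tuple_length_finite) (auto simp: magnitude_basis_def)
  moreover have "xs \<noteq> []" using xs by (auto simp: magnitude_basis_def)
  ultimately show "xs \<in> {xs \<in> order_complex P. r (last xs) - r (hd xs) = k \<and> length xs = Suc m}"
    using xs tuple_length_sorted[of xs] by (auto simp: magnitude_basis_def order_complex_def)
next
  fix xs assume "xs \<in> {xs \<in> order_complex P. r (last xs) - r (hd xs) = k \<and> length xs = Suc m}"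
  moreover from this have "\<forall>i<m. xs ! i < xs ! Suc i"
    by (auto simp: order_complex_def intro: sorted_wrt_nth_less)
  ultimately show "xs \<in> magnitude_basis P r k m"
    using tuple_length_sorted[of xs] by (fastforce simp: magnitude_basis_def order_complex_def)
qed

lemma short_basis_diff: "short_basis (Suc k) m - short_basis k m = magnitude_basis P r k m"
  by (auto simp: magnitude_basis_eq short_complex_def)

lemma finite_short_basis: "finite (short_basis k m)"
  by (rule finite_subset[OF _ finite_lists_length_eq[OF finite_P, of "Suc m"]])
    (auto simp: short_complex_def order_complex_def)

lemma finite_magnitude_basis: "finite (magnitude_basis P r k m)"
  unfolding short_basis_diff[symmetric] by (intro finite_Diff finite_short_basis)

lemma short_basis_empty: "k \<le> m \<Longrightarrow> short_basis k m = {}"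
  using rank_hd_last by (fastforce simp: short_complex_def order_complex_def)

lemma delete_nth_order_complex:
  assumes "xs \<in> order_complex P" and "i < length xs" and "2 \<le> length xs"
  shows "delete_nth i xs \<in> order_complex P"
    and "r (last (delete_nth i xs)) - r (hd (delete_nth i xs)) \<le> r (last xs) - r (hd xs)"
proof -
  let ?ys = "delete_nth i xs"
  have xs: "sorted_wrt (<) xs" "set xs \<subseteq> P" using assms(1) by (auto simp: order_complex_def)
  have "length ?ys \<noteq> 0" using assms by (simp add: length_delete_nth)
  then have ne: "?ys \<noteq> []" by simp
  then show "?ys \<in> order_complex P"
    using xs set_delete_nth[of i xs] by (auto simp: order_complex_def sorted_wrt_delete_nth)
  have mem: "hd ?ys \<in> set xs" "last ?ys \<in> set xs" "hd xs \<in> set xs" "last xs \<in> set xs"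
    using ne set_delete_nth[of i xs] hd_in_set[of ?ys] last_in_set[of ?ys]
      hd_in_set[of xs] last_in_set[of xs] assms(2) by fastforce+
  have "r (hd xs) \<le> r (hd ?ys)"
    using mem xs by (intro rank_le sorted_less_hd_le) auto
  moreover have "r (last ?ys) \<le> r (last xs)"
    using mem xs by (intro rank_le sorted_less_le_last) auto
  ultimately show "r (last ?ys) - r (hd ?ys) \<le> r (last xs) - r (hd xs)" by simp
qed

section \<open>One filtration step and its quotient\<close>

lemma based_complex_short: "based_complex (short_basis k) simplicial_boundary"
  by (rule based_complex_simplicial)
    (use delete_nth_order_complex in \<open>fastforce simp: short_complex_def\<close>)

text \<open>A face of a chain of rank difference \<open>k\<close> either keeps that difference and
  survives in the magnitude boundary, or drops below \<open>k\<close> and lies in the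
  subcomplex.\<close>

lemma based_complex_pair_short:
  "based_complex_pair (short_basis k) (short_basis (Suc k)) simplicial_boundary (magnitude_boundary r k)"
proof (intro based_complex_pair.intro based_complex_short based_complex_pair_axioms.intro)
  show "short_basis k m \<subseteq> short_basis (Suc k) m" for m
    by (auto simp: short_complex_def)
  show "additive (magnitude_boundary r k m)" for m
    by (rule additive_magnitude_boundary)
  show "magnitude_boundary r k 0 c = 0" for c
    by (simp add: magnitude_boundary_def)
  fix c and m
  assume c: "c \<in> chains_on (short_basis (Suc k) (Suc m) - short_basis k (Suc m))"
  have tuple: "tuple_length r (delete_nth i xs)
        = enat (r (last (delete_nth i xs)) - r (hd (delete_nth i xs)))"
    and delete: "delete_nth i xs \<in> short_basis (Suc k) m"
    if "xs \<in> short_basis (Suc k) (Suc m) - short_basis k (Suc m)" "i \<le> Suc m" for xs i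
  proof -
    have xs: "xs \<in> order_complex P" "i < length xs" "2 \<le> length xs"
      "r (last xs) - r (hd xs) = k" "length xs = Suc (Suc m)"
      using that by (auto simp: short_complex_def)
    note del = delete_nth_order_complex[OF xs(1-3)]
    show "tuple_length r (delete_nth i xs)
        = enat (r (last (delete_nth i xs)) - r (hd (delete_nth i xs)))"
      using del(1) by (intro tuple_length_sorted) (auto simp: order_complex_def)
    show "delete_nth i xs \<in> short_basis (Suc k) m"
      using del xs by (simp add: short_complex_def length_delete_nth)
  qed
  have magnitude: "magnitude_boundary r k (Suc m) (frag_of xs) = (\<Sum>i\<le>Suc m. frag_cmul ((-1) ^ i)
      (if tuple_length r (delete_nth i xs) = enat k then frag_of (delete_nth i xs) else 0))" for xs
    by (simp only: magnitude_boundary_def frag_extend_of nat.simps if_False)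
  show "magnitude_boundary r k (Suc m) c \<in> chains_on (short_basis (Suc k) m - short_basis k m)"
  proof (rule additive_in_chains[OF additive_magnitude_boundary c])
    fix xs assume xs: "xs \<in> short_basis (Suc k) (Suc m) - short_basis k (Suc m)"
    show "magnitude_boundary r k (Suc m) (frag_of xs)
        \<in> chains_on (short_basis (Suc k) m - short_basis k m)"
      unfolding magnitude
    proof (intro sum_closed_free_Abelian_group frag_cmul_in_chains)
      fix i assume "i \<in> {..Suc m}"
      then have i: "i \<le> Suc m" by simp
      show "(if tuple_length r (delete_nth i xs) = enat k then frag_of (delete_nth i xs) else 0)
          \<in> chains_on (short_basis (Suc k) m - short_basis k m)"
        using tuple[OF xs i] delete[OF xs i] by (auto simp: short_complex_def)
    qed
  qed
  show "simplicial_boundary (Suc m) c - magnitude_boundary r k (Suc m) c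
      \<in> chains_on (short_basis k m)"
  proof (rule additive_in_chains[OF _ c,
        where h = "\<lambda>c. simplicial_boundary (Suc m) c - magnitude_boundary r k (Suc m) c"])
    show "additive (\<lambda>c :: 'a list \<Rightarrow>\<^sub>0 int.
        simplicial_boundary (Suc m) c - magnitude_boundary r k (Suc m) c)"
      by (simp add: additive_def additive.add[OF additive_simplicial_boundary]
          additive.add[OF additive_magnitude_boundary])
    fix xs assume xs: "xs \<in> short_basis (Suc k) (Suc m) - short_basis k (Suc m)"
    have "simplicial_boundary (Suc m) (frag_of xs) - magnitude_boundary r k (Suc m) (frag_of xs)
        = (\<Sum>i\<le>Suc m. frag_cmul ((-1) ^ i) (frag_of (delete_nth i xs)) - frag_cmul ((-1) ^ i)
            (if tuple_length r (delete_nth i xs) = enat k then frag_of (delete_nth i xs) else 0))"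
      by (simp only: magnitude simplicial_boundary_frag_of sum_subtractf)
    also have "\<dots> \<in> chains_on (short_basis k m)"
    proof (rule sum_closed_free_Abelian_group)
      fix i assume "i \<in> {..Suc m}"
      then have i: "i \<le> Suc m" by simp
      show "frag_cmul ((-1) ^ i) (frag_of (delete_nth i xs)) - frag_cmul ((-1) ^ i)
            (if tuple_length r (delete_nth i xs) = enat k then frag_of (delete_nth i xs) else 0)
          \<in> chains_on (short_basis k m)"
      \<comment> \<open>Either the two summands cancel, or the magnitude summand is 0 and the face
        is short.\<close>
      proof (cases "tuple_length r (delete_nth i xs) = enat k")
        case True
        then show ?thesis by simp
      next
        case False
        then have "delete_nth i xs \<in> short_basis k m"
          using tuple[OF xs i] delete[OF xs i] by (auto simp: short_complex_def)
        then have "frag_cmul ((-1) ^ i) (frag_of (delete_nth i xs)) \<in> chains_on (short_basis k m)"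
          by (intro frag_cmul_in_chains) simp
        with False show ?thesis by simp
      qed
    qed
    finally show "simplicial_boundary (Suc m) (frag_of xs) - magnitude_boundary r k (Suc m) (frag_of xs)
        \<in> chains_on (short_basis k m)" .
  qed
qed

section \<open>Philip Hall's theorem\<close>

definition chains_between :: "nat \<Rightarrow> 'a \<Rightarrow> 'a \<Rightarrow> 'a list set" where
  "chains_between m x y =
     {xs \<in> order_complex P. length xs = Suc m \<and> hd xs = x \<and> last xs = y}"

lemma finite_chains_between: "finite (chains_between m x y)"
  by (rule finite_subset[OF _ finite_lists_length_eq[OF finite_P, of "Suc m"]])
    (auto simp: chains_between_def order_complex_def)

lemma chains_between_0: "x \<in> P \<Longrightarrow> chains_between 0 x y = (if x = y then {[x]} else {})"
  by (auto simp: chains_between_def order_complex_def length_Suc_conv)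

text \<open>The last vertex is split off, rather than the first, to match the recursion of
  \<open>mobius\<close> in its upper argument.\<close>

lemma chains_between_Suc:
  assumes "y \<in> P"
  shows "chains_between (Suc m) x y =
    (\<lambda>xs. xs @ [y]) ` (\<Union>z\<in>{z \<in> P. x \<le> z \<and> z < y}. chains_between m x z)" (is "_ = ?R")
proof (rule Set.set_eqI, rule iffI)
  fix xs assume xs: "xs \<in> chains_between (Suc m) x y"
  then have ne: "xs \<noteq> []" "length xs = Suc (Suc m)" by (auto simp: chains_between_def)
  define ys where "ys = butlast xs"
  have eq: "xs = ys @ [y]" using xs append_butlast_last_id[OF ne(1)] by (simp add: ys_def chains_between_def)
  have "length ys = Suc m" using ne by (simp add: ys_def)
  then have ys: "ys \<noteq> []" "length ys = Suc m" by auto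
  have sorted: "sorted_wrt (<) ys" "\<forall>z\<in>set ys. z < y" "set ys \<subseteq> P" "hd ys = x"
    using xs ys(1) unfolding eq by (auto simp: chains_between_def order_complex_def sorted_wrt_append)
  have "last ys \<in> {z \<in> P. x \<le> z \<and> z < y}"
    using sorted ys(1) sorted_less_hd_le[of ys "last ys"] by auto
  moreover have "ys \<in> chains_between m x (last ys)"
    using sorted ys by (auto simp: chains_between_def order_complex_def)
  ultimately show "xs \<in> ?R" unfolding eq by blast
next
  fix xs assume "xs \<in> ?R"
  then obtain z ys where z: "z \<in> P" "z < y" and ys: "ys \<in> chains_between m x z" and eq: "xs = ys @ [y]"
    by blast
  have "u < y" if "u \<in> set ys" for u
  proof -
    have "u \<le> z"
      using ys that sorted_less_le_last[of ys u] by (auto simp: chains_between_def order_complex_def)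
    then show ?thesis using z(2) by (rule le_less_trans)
  qed
  then show "xs \<in> chains_between (Suc m) x y"
    using ys assms by (auto simp: eq chains_between_def order_complex_def sorted_wrt_append)
qed

lemma card_chains_between_Suc:
  assumes "y \<in> P"
  shows "card (chains_between (Suc m) x y) =
    (\<Sum>z\<in>{z \<in> P. x \<le> z \<and> z < y}. card (chains_between m x z))"
  unfolding chains_between_Suc[OF assms]
proof (subst card_image)
  show "card (\<Union>z\<in>{z \<in> P. x \<le> z \<and> z < y}. chains_between m x z) =
      (\<Sum>z\<in>{z \<in> P. x \<le> z \<and> z < y}. card (chains_between m x z))"
    using finite_P finite_chains_between
    by (intro card_UN_disjoint) (auto simp: chains_between_def)
qed (simp add: inj_on_def)

text \<open>Philip Hall's theorem, by induction on a bound \<open>N\<close> for the rank difference: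
  passing from \<open>y\<close> to \<open>z < y\<close> lowers the rank, so the smaller bound
  applies to all values in the recursion of \<open>mobius\<close>.\<close>

lemma mobius_eq_alternating_sum:
  assumes "x \<in> P" "y \<in> P" "x \<le> y" "r y - r x \<le> N"
  shows "mobius P x y = (\<Sum>m\<le>N. (-1) ^ m * int (card (chains_between m x y)))"
  using assms(2-)
proof (induction N arbitrary: y)
  \<comment> \<open>Stated for every \<open>N\<close>, since the case \<open>x = y\<close> recurs at
    each stage of the induction.\<close>
  have refl: "mobius P x x = (\<Sum>m\<le>N. (-1) ^ m * int (card (chains_between m x x)))" for N
  proof -
    have "{z \<in> P. x \<le> z \<and> z < x} = {}"
      by (auto simp: less_le_not_le)
    then have "card (chains_between (Suc m) x x) = 0" for m
      by (simp only: card_chains_between_Suc[OF assms(1)] sum.empty)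
    then show ?thesis
      by (subst mobius.simps) (simp add: sum.atMost_shift chains_between_0[OF assms(1)])
  qed
  {
    case 0
    then have "x = y" using rank_less[OF assms(1), of y] by (auto simp: order.order_iff_strict)
    then show ?case using refl[of 0] by simp
  next
    case (Suc N)
    show ?case
    proof (cases "x = y")
      case True
      then show ?thesis using refl by simp
    next
      case False
      with Suc.prems have less: "x < y" by simp
      let ?Z = "{z \<in> P. x \<le> z \<and> z < y}"
      have IH: "mobius P x z = (\<Sum>m\<le>N. (-1) ^ m * int (card (chains_between m x z)))"
        if "z \<in> ?Z" for z
        using that Suc.prems rank_less[of z y] rank_le[of x z] assms(1) by (intro Suc.IH) auto
      have "mobius P x y = - (\<Sum>z\<in>?Z. mobius P x z)"
          using False less finite_P by (subst mobius.simps) simp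
      also have "\<dots> = - (\<Sum>z\<in>?Z. \<Sum>m\<le>N. (-1) ^ m * int (card (chains_between m x z)))"
        by (simp only: IH cong: sum.cong)
      also have "\<dots> = - (\<Sum>m\<le>N. \<Sum>z\<in>?Z. (-1) ^ m * int (card (chains_between m x z)))"
        by (subst sum.swap) simp
      \<comment> \<open>Appending \<open>y\<close> lengthens each chain by one, which absorbs the
        minus sign of the recursion.\<close>
      also have "\<dots> = (\<Sum>m\<le>N. (-1) ^ Suc m * int (card (chains_between (Suc m) x y)))"
        unfolding card_chains_between_Suc[OF Suc.prems(1)] of_nat_sum sum_distrib_left sum_negf[symmetric]
        by simp
      \<comment> \<open>The added term for \<open>m = 0\<close> is zero: a single vertex cannot join
        distinct end points.\<close>
      also have "\<dots> = (\<Sum>m\<le>Suc N. (-1) ^ m * int (card (chains_between m x y)))"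
        using False
        by (simp add: sum.atMost_shift[of _ "Suc N"] lessThan_Suc_atMost chains_between_0[OF assms(1)]
            del: sum.atMost_Suc)
      finally show ?thesis .
    qed
  }
qed

abbreviation intervals :: "nat \<Rightarrow> ('a \<times> 'a) set" where
  "intervals k \<equiv> {(x, y). x \<in> P \<and> y \<in> P \<and> x \<le> y \<and> r y - r x = k}"

lemma finite_intervals: "finite (intervals k)"
  by (rule finite_subset[of _ "P \<times> P"]) (use finite_P in auto)

lemma card_magnitude_basis:
  "card (magnitude_basis P r k m) = (\<Sum>(x, y)\<in>intervals k. card (chains_between m x y))"
proof -
  let ?g = "\<lambda>xs :: 'a list. (hd xs, last xs)"
  let ?M = "magnitude_basis P r k m"
  have "?g xs \<in> intervals k" if "xs \<in> ?M" for xs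
    using that sorted_less_hd_le[of xs "last xs"] hd_in_set[of xs] last_in_set[of xs]
    by (auto simp: magnitude_basis_eq order_complex_def)
  then have "?g ` ?M \<subseteq> intervals k" by blast
  then have "(\<Sum>p\<in>intervals k. card {xs \<in> ?M. ?g xs = p}) = card ?M"
    using sum.group[OF finite_magnitude_basis finite_intervals, of ?g _ _ _ "\<lambda>_. 1::nat"] by simp
  moreover have "{xs \<in> ?M. ?g xs = (x, y)} = chains_between m x y" if "(x, y) \<in> intervals k" for x y
    using that by (auto simp: magnitude_basis_eq chains_between_def)
  then have "(\<Sum>p\<in>intervals k. card {xs \<in> ?M. ?g xs = p})
      = (\<Sum>(x, y)\<in>intervals k. card (chains_between m x y))"
    by (intro sum.cong) auto
  ultimately show ?thesis by simp
qed

text \<open>Sorting the basis by end points turns the sum into one over intervals of rank difference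
  \<open>k\<close>, and Hall's theorem applies to each of them with \<open>N = k\<close>.\<close>

lemma magnitude_euler_characteristic:
  "(\<Sum>m\<le>k. (-1) ^ m * int (card (magnitude_basis P r k m))) = (\<Sum>(x, y)\<in>intervals k. mobius P x y)"
proof -
  have "(\<Sum>m\<le>k. (-1) ^ m * int (card (magnitude_basis P r k m)))
      = (\<Sum>m\<le>k. \<Sum>(x, y)\<in>intervals k. (-1) ^ m * int (card (chains_between m x y)))"
    unfolding card_magnitude_basis of_nat_sum sum_distrib_left
    by (simp only: case_prod_unfold)
  also have "\<dots> = (\<Sum>(x, y)\<in>intervals k. \<Sum>m\<le>k. (-1) ^ m * int (card (chains_between m x y)))"
    by (simp only: case_prod_unfold) (rule sum.swap)
  also have "\<dots> = (\<Sum>(x, y)\<in>intervals k. mobius P x y)"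
  proof (rule sum.cong)
    fix p assume "p \<in> intervals k"
    then obtain x y where "p = (x, y)" "x \<in> P" "y \<in> P" "x \<le> y" "r y - r x = k" by blast
    then show "(case p of (x, y) \<Rightarrow> \<Sum>m\<le>k. (-1) ^ m * int (card (chains_between m x y)))
        = (case p of (x, y) \<Rightarrow> mobius P x y)"
      using mobius_eq_alternating_sum[of x y k] by simp
  qed simp
  finally show ?thesis .
qed

section \<open>Diagonal magnitude homology\<close>

lemma iso_short_step:
  assumes "diagonal_magnitude_homology P r" and "i < k"
  shows "simplicial_homology i (short_complex (Suc k)) \<cong> simplicial_homology i (short_complex (Suc (Suc k)))"
proof -
  interpret based_complex_pair "short_basis (Suc k)" "short_basis (Suc (Suc k))" simplicial_boundary
    "magnitude_boundary r (Suc k)"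
    by (rule based_complex_pair_short)
  have "quotient.cycles m = quotient.boundaries m" if "m \<noteq> Suc k" for m
    using assms(1) that
    by (intro quotient.trivial_homologyD)
      (simp add: short_basis_diff diagonal_magnitude_homology_def magnitude_homology_def)
  then show ?thesis
    unfolding simplicial_homology_def using assms(2) by (intro homology_iso) auto
qed

lemma iso_short:
  assumes "diagonal_magnitude_homology P r" and "i < k" and "k \<le> l"
  shows "simplicial_homology i (short_complex (Suc k)) \<cong> simplicial_homology i (short_complex (Suc l))"
  using assms(3)
proof (induction l rule: dec_induct)
  case base
  show ?case by (rule iso_refl)
next
  case (step l)
  then have "simplicial_homology i (short_complex (Suc l)) \<cong> simplicial_homology i (short_complex (Suc (Suc l)))"
    using assms by (intro iso_short_step) auto
  with step.IH show ?case by (rule iso_trans)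
qed

lemma abelian_rank_short:
  assumes "diagonal_magnitude_homology P r"
  shows "abelian_rank (simplicial_homology k (short_complex (Suc k)))
    \<le> enat (nat (\<Sum>(x, y)\<in>intervals k. \<bar>mobius P x y\<bar>))"
proof -
  interpret based_complex_pair "short_basis k" "short_basis (Suc k)" simplicial_boundary
    "magnitude_boundary r k"
    by (rule based_complex_pair_short)
  have exact: "quotient.cycles m = quotient.boundaries m" if "m < k" for m
    using assms that
    by (intro quotient.trivial_homologyD)
      (simp add: short_basis_diff diagonal_magnitude_homology_def magnitude_homology_def)
  have fin: "finite (short_basis (Suc k) m - short_basis k m)" for m
    by (intro finite_Diff finite_short_basis)
  have "int (frag_rank (quotient.cycles k))
      = (-1) ^ k * (\<Sum>m\<le>k. (-1) ^ m * int (card (short_basis (Suc k) m - short_basis k m)))"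
    by (rule quotient.rank_cycles_exact[OF fin exact])
  also have "\<dots> = (-1) ^ k * (\<Sum>(x, y)\<in>intervals k. mobius P x y)"
    by (simp only: short_basis_diff magnitude_euler_characteristic)
  \<comment> \<open>The sign depends only on \<open>k\<close>, so it disappears under the absolute
    value.\<close>
  also have "\<dots> \<le> \<bar>\<Sum>(x, y)\<in>intervals k. mobius P x y\<bar>"
    using abs_ge_self[of "(-1) ^ k * (\<Sum>(x, y)\<in>intervals k. mobius P x y)"]
    by (simp add: abs_mult power_abs)
  also have "\<dots> \<le> (\<Sum>(x, y)\<in>intervals k. \<bar>mobius P x y\<bar>)"
    using sum_abs[of "\<lambda>(x, y). mobius P x y" "intervals k"] by (simp add: case_prod_unfold)
  finally have rank: "frag_rank (quotient.cycles k) \<le> nat (\<Sum>(x, y)\<in>intervals k. \<bar>mobius P x y\<bar>)"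
    by simp
  \<comment> \<open>The first equation makes every \<open>k\<close>-chain of the larger complex a
    relative chain; the second leaves no nonzero boundaries in degree \<open>k\<close>.\<close>
  have empty: "short_basis k k = {}" "short_basis (Suc k) (Suc k) = {}"
    by (rule short_basis_empty, simp)+
  have "super.cycles k \<subseteq> quotient.cycles k"
  proof
    fix c assume c: "c \<in> super.cycles k"
    then have "c \<in> chains_on (short_basis (Suc k) k - short_basis k k)" "simplicial_boundary k c = 0"
      unfolding super.cycles_def empty(1) by simp_all
    then show "c \<in> quotient.cycles k"
      by (intro quotient_cycleI) simp_all
  qed
  then have "frag_rank (super.cycles k) \<le> frag_rank (quotient.cycles k)"
    by (rule frag_rank_mono[OF fin[of k], rotated]) (auto simp: quotient.cycles_def)
  moreover have "abelian_rank (simplicial_homology k (short_complex (Suc k)))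
      \<le> enat (frag_rank (super.cycles k))"
    unfolding simplicial_homology_def
    by (rule super.abelian_rank_homology_le[OF finite_short_basis empty(2)])
  ultimately show ?thesis using rank by (meson enat_ord_simps(1) order_trans)
qed

end

text \<open>Induction on the number of elements strictly between \<open>x\<close> and
  \<open>y\<close>: if there are none, \<open>y\<close> covers \<open>x\<close>; otherwise an
  intermediate \<open>z\<close> splits the interval, and both halves have fewer inner elements
  because they omit \<open>z\<close>.\<close>

lemma graded_poset_rank_less:
  assumes "graded_poset P r n" "x \<in> P" "y \<in> P" "x < y"
  shows "r x < r y"
  using assms(2-)
proof (induction "card {z \<in> P. x < z \<and> z < y}" arbitrary: x y rule: less_induct)
  case less
  have fin: "finite P" using assms(1) by (simp add: graded_poset_def)
  show ?case
  proof (cases "\<exists>z\<in>P. x < z \<and> z < y")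
    case False
    then have "covers_in P y x" using less.prems by (simp add: covers_in_def)
    then show ?thesis using assms(1) by (simp add: graded_poset_def)
  next
    case True
    then obtain z where z: "z \<in> P" "x < z" "z < y" by blast
    have "card {u \<in> P. x < u \<and> u < z} < card {u \<in> P. x < u \<and> u < y}"
      by (rule psubset_card_mono) (use fin z in auto)
    then have "r x < r z" using less z by blast
    have "card {u \<in> P. z < u \<and> u < y} < card {u \<in> P. x < u \<and> u < y}"
      by (rule psubset_card_mono) (use fin z in auto)
    then have "r z < r y" using less z by blast
    with \<open>r x < r z\<close> show ?thesis by simp
  qed
qed

theorem theorem1:
  fixes P :: "'a::order set" and r :: "'a \<Rightarrow> nat" and n k :: nat
  assumes "graded_poset P r n"
    and "diagonal_magnitude_homology P r"
    and "k \<le> n"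
  shows "(\<forall>i<k. simplicial_homology i (rank_order_complex P r k) \<cong>
                simplicial_homology i (order_complex P)) \<and>
         abelian_rank (simplicial_homology k (rank_order_complex P r k)) \<le>
           enat (nat (\<Sum>(x, y)\<in>{(x, y). x \<in> P \<and> y \<in> P \<and> x \<le> y \<and> r y - r x = k}.
                        \<bar>mobius P x y\<bar>))"
proof -
  interpret ranked_poset P r
    using graded_poset_rank_less[OF assms(1)] assms(1)
    by unfold_locales (auto simp: graded_poset_def)
  \<comment> \<open>Ranks are at most \<open>n\<close>, so the filtration has exhausted the order
    complex at index \<open>Suc n\<close>.\<close>
  have "r (last xs) - r (hd xs) \<le> n" if "xs \<in> order_complex P" for xs
  proof -
    have "last xs \<in> P" using that last_in_set by (auto simp: order_complex_def)
    then have "r (last xs) \<le> n" using assms(1) by (simp add: graded_poset_def)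
    then show ?thesis by simp
  qed
  then have "short_complex (Suc n) = order_complex P"
    by (auto simp: short_complex_def less_Suc_eq_le)
  then show ?thesis
    using iso_short[OF assms(2) _ assms(3)] abelian_rank_short[OF assms(2), of k]
    by (simp add: short_complex_Suc)
qed

end
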